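(* Let $p,q$ be coprime positive integers, $P={}^t(p,q)$, and let $d\ge 1$, $r>0$ be integers. For any link $L\in \mathcal L(P;dpq,r)$ there exists a smooth elimination family $L(t)$, $0\le t\le 1$, of a pair of links (as defined in the context) with $L(0)=L$ and $L(1)\in \mathcal L(P;dpq,r-1)$.
   Context: Let $S^3=\{(z_1,z_2)\in\mathbb C^2 : |z_1|^2+|z_2|^2=1\}$ and let $S^1=\{\rho\in\mathbb C:|\rho|=1\}$ act on $S^3$ by $\rho\circ(z_1,z_2)=(z_1\rho^p,z_2\rho^q)$. The orbits $z_1=0$ and $z_2=0$ are called singular; all other orbits are regular, and each orbit has a canonical (positive) orientation induced by the action. A mixed polynomial $f(\mathbf z,\bar{\mathbf z})=\sum_{\nu,\mu} c_{\nu,\mu}\mathbf z^\nu\bar{\mathbf z}^\mu$ in $\mathbf z=(z_1,z_2)$ is strongly polar weighted homogeneous with weight vector $P={}^t(p,q)$, radial degree $d_r$ and polar degree $d_p$ if $p(\nu_1+\mu_1)+q(\nu_2+\mu_2)=d_r$ and $p(\nu_1-\mu_1)+q(\nu_2-\mu_2)=d_p$ whenever $c_{\nu,\mu}\neq 0$. It is convenient if for each $j=1,2$ it contains, with nonzero coefficient, a monomial $z_j^{a_j}\bar z_j^{b_j}$ in $z_j,\bar z_j$ only; it is non-degenerate if the real differential of $f:(\mathbb C^* )^2\to\mathbb C\cong\mathbb R^2$ has rank 2 at every zero of $f$ in $(\mathbb C^* )^2$. $\mathcal L(P;d_p)$ is the set of oriented links $f^{-1}(0)\cap S^3$ with $f$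 a convenient non-degenerate strongly polar weighted homogeneous mixed polynomial with weight $P$ and polar degree $d_p$ (the radial degree is arbitrary); the orientation is that of the transverse zero set of $f|_{S^3}:S^3\to\mathbb C$. Such a link is a finite union of regular orbits, each carrying either its positive orientation or the reversed (negative) one. $\mathcal L(P;dpq,r)$ is the subspace of links in $\mathcal L(P;dpq)$ having $d+2r$ components, of which exactly $r$ are negatively oriented. A smooth elimination family of a pair of links is a smooth family $L(t)$, $0\le t\le 1$, of strongly polar weighted homogeneous links of weight $P$ and polar degree $dpq$ (that is, $L(t)=f_t^{-1}(0)\cap S^3$ with $f_t$ strongly polar weighted homogeneous of weight $P$ and polar degree $dpq$ and depending smoothly on $t$) such that: (1) $W=\{(\mathbf z,t)\in S^3\times[0,1] : \mathbf z\in L(t)\}$ is smooth of codimension two in $S^3\times[0,1]$; (2) there exists $t_0$ with $0<t_0<1$ such that $L(t)\in\mathcal L(P;dpq,r)$ for $t<t_0$ and $L(t)\in\mathcal L(P;dpq,r-1)$ for $t>t_0$; the link $L(t_0)$ is singular, one of its components being the limit of two components of $L(t)$ with opposite orientations. *)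

theory Defs
  imports "HOL-Analysis.Analysis" "HOL-Library.Poly_Mapping"
begin

section \<open>Mixed polynomials in two complex variables\<close>

type_synonym C2 = "complex \<times> complex"

text \<open>The key \<open>((\<nu>\<^sub>1, \<nu>\<^sub>2), (\<mu>\<^sub>1, \<mu>\<^sub>2))\<close> stands for the monomial
  \<open>z\<^sub>1^\<nu>\<^sub>1 * z\<^sub>2^\<nu>\<^sub>2 * cnj z\<^sub>1^\<mu>\<^sub>1 * cnj z\<^sub>2^\<mu>\<^sub>2\<close>.\<close>

type_synonym mixed_poly = "((nat \<times> nat) \<times> (nat \<times> nat)) \<Rightarrow>\<^sub>0 complex"

definition mixed_eval :: "mixed_poly \<Rightarrow> C2 \<Rightarrow> complex" where
  "mixed_eval f = (\<lambda>(z1, z2). \<Sum>((n1, n2), (m1, m2)) \<in> Poly_Mapping.keys f.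
     Poly_Mapping.lookup f ((n1, n2), (m1, m2)) * (z1 ^ n1 * z2 ^ n2 * cnj z1 ^ m1 * cnj z2 ^ m2))"

definition strongly_polar_weighted_homogeneous ::
    "nat \<Rightarrow> nat \<Rightarrow> nat \<Rightarrow> int \<Rightarrow> mixed_poly \<Rightarrow> bool" where
  "strongly_polar_weighted_homogeneous p q dr dp f \<longleftrightarrow>
     (\<forall>((n1, n2), (m1, m2)) \<in> Poly_Mapping.keys f.
        p * (n1 + m1) + q * (n2 + m2) = dr \<and>
        int p * (int n1 - int m1) + int q * (int n2 - int m2) = dp)"

definition convenient :: "mixed_poly \<Rightarrow> bool" where
  "convenient f \<longleftrightarrow>
     (\<exists>a b. Poly_Mapping.lookup f ((a, 0), (b, 0)) \<noteq> 0) \<and>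
     (\<exists>a b. Poly_Mapping.lookup f ((0, a), (0, b)) \<noteq> 0)"

text \<open>\<open>dim\<close> is the real dimension, so this is the rank of the real differential.\<close>

definition nondegenerate :: "mixed_poly \<Rightarrow> bool" where
  "nondegenerate f \<longleftrightarrow>
     (\<forall>z1 z2. z1 \<noteq> 0 \<longrightarrow> z2 \<noteq> 0 \<longrightarrow> mixed_eval f (z1, z2) = 0 \<longrightarrow>
        dim (range (frechet_derivative (mixed_eval f) (at (z1, z2)))) = 2)"


section \<open>Oriented links in the three-sphere\<close>

definition link_of :: "mixed_poly \<Rightarrow> C2 set" where
  "link_of f = {z \<in> sphere 0 1. mixed_eval f z = 0}"

text \<open>The tangent space of the unit sphere at \<open>z\<close> is the real orthogonal complement of \<open>z\<close>.\<close>

definition transverse_at :: "mixed_poly \<Rightarrow> C2 \<Rightarrow> bool" where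
  "transverse_at f z \<longleftrightarrow>
     frechet_derivative (mixed_eval f) (at z) ` {v. z \<bullet> v = 0} = UNIV"

definition real_coords :: "C2 \<Rightarrow> real^4" where
  "real_coords z = vector [Re (fst z), Im (fst z), Re (snd z), Im (snd z)]"

definition det4 :: "C2 \<Rightarrow> C2 \<Rightarrow> C2 \<Rightarrow> C2 \<Rightarrow> real" where
  "det4 a b c d =
     det (vector [real_coords a, real_coords b, real_coords c, real_coords d] :: real^4^4)"

text \<open>Orientation of the zero set: the sphere is oriented as the boundary of the unit ball in
  \<open>\<complex>\<^sup>2\<close> (outward normal first), and the normal bundle of the zero set is oriented by the
  differential of \<open>f\<close> onto \<open>\<complex>\<close>. So \<open>v\<close> is positive if \<open>(z, w1, w2, v)\<close> is a positive
  basis of \<open>\<complex>\<^sup>2\<close>, where the sphere tangent vectors \<open>w1, w2\<close> are mapped to the positive basis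
  \<open>(1, \<i>)\<close> of \<open>\<complex>\<close>. The choice of \<open>w1, w2\<close> is irrelevant: they are unique up to
  multiples of \<open>v\<close>. No \<open>v\<close> is positive at a point where \<open>f\<close> is not transverse. For
  holomorphic \<open>f\<close> this is the complex orientation, i.e. it agrees with the orbits of the action.\<close>

definition positive_tangent :: "mixed_poly \<Rightarrow> C2 \<Rightarrow> C2 \<Rightarrow> bool" where
  "positive_tangent f z v \<longleftrightarrow>
     (let D = frechet_derivative (mixed_eval f) (at z) in
        z \<bullet> v = 0 \<and> D v = 0 \<and>
        (\<exists>w1 w2. z \<bullet> w1 = 0 \<and> z \<bullet> w2 = 0 \<and> D w1 = 1 \<and> D w2 = \<i> \<and> det4 z w1 w2 v > 0))"

text \<open>An oriented link: the point set together with the set of all pairs \<open>(z, v)\<close> such that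
  \<open>v\<close> is a positively oriented nonzero tangent vector at the point \<open>z\<close> of the link.\<close>

type_synonym oriented_link = "C2 set \<times> (C2 \<times> C2) set"

definition oriented_link_of :: "mixed_poly \<Rightarrow> oriented_link" where
  "oriented_link_of f = (link_of f, {(z, v). z \<in> link_of f \<and> positive_tangent f z v})"

definition link_space :: "nat \<Rightarrow> nat \<Rightarrow> int \<Rightarrow> oriented_link set" where
  "link_space p q dp =
     {oriented_link_of f | f. convenient f \<and> nondegenerate f \<and>
        (\<exists>dr. strongly_polar_weighted_homogeneous p q dr dp f)}"

text \<open>The velocity at \<open>\<theta> = 0\<close> of \<open>\<theta> \<mapsto> (z\<^sub>1 * exp (\<i> p \<theta>), z\<^sub>2 * exp (\<i> q \<theta>))\<close>,
  which defines the canonical orientation of the orbit through \<open>z\<close>.\<close>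

definition orbit_velocity :: "nat \<Rightarrow> nat \<Rightarrow> C2 \<Rightarrow> C2" where
  "orbit_velocity p q z = (\<i> * of_nat p * fst z, \<i> * of_nat q * snd z)"

definition positive_components :: "nat \<Rightarrow> nat \<Rightarrow> oriented_link \<Rightarrow> C2 set set" where
  "positive_components p q L =
     {C \<in> components (fst L). \<forall>z\<in>C. (z, orbit_velocity p q z) \<in> snd L}"

definition negative_components :: "nat \<Rightarrow> nat \<Rightarrow> oriented_link \<Rightarrow> C2 set set" where
  "negative_components p q L =
     {C \<in> components (fst L). \<forall>z\<in>C. (z, - orbit_velocity p q z) \<in> snd L}"

definition link_space_neg :: "nat \<Rightarrow> nat \<Rightarrow> nat \<Rightarrow> nat \<Rightarrow> oriented_link set" where
  "link_space_neg p q d r =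
     {L \<in> link_space p q (int (d * p * q)).
        card (components (fst L)) = d + 2 * r \<and> card (negative_components p q L) = r}"


section \<open>Smooth elimination families\<close>

text \<open>\<open>C\<^sup>\<infinity>\<close> maps: \<open>D [v\<^sub>1, \<dots>, v\<^sub>k]\<close> is the iterated directional derivative of \<open>g\<close>, and every
  iterated directional derivative is again Frechet differentiable. It is used only for open \<open>S\<close>
  and for \<open>S = {0..1}\<close> (with one-sided derivatives at the end points), where derivatives
  within \<open>S\<close> are unique.\<close>

definition smooth_map_on ::
    "'a::real_normed_vector set \<Rightarrow> ('a \<Rightarrow> 'b::real_normed_vector) \<Rightarrow> bool" where
  "smooth_map_on S g \<longleftrightarrow>
     (\<exists>D :: 'a list \<Rightarrow> 'a \<Rightarrow> 'b. (\<forall>x\<in>S. D [] x = g x) \<and>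
        (\<forall>vs. \<forall>x\<in>S. (D vs has_derivative (\<lambda>v. D (v # vs) x)) (at x within S)))"

text \<open>Smooth submanifolds (with boundary) of codimension two of \<open>S\<^sup>3 \<times> [0,1]\<close>: locally the zero
  set of a smooth \<open>\<complex>\<close>-valued map whose differential has rank two on the tangent space of
  \<open>S\<^sup>3 \<times> [0,1]\<close>. At a point of \<open>S\<^sup>3 \<times> {0,1}\<close> rank two is required on the tangent space of the
  boundary, i.e. the submanifold meets the boundary transversally; otherwise a zero set need not be
  a manifold with boundary there.\<close>

definition smooth_codim_two :: "(C2 \<times> real) set \<Rightarrow> bool" where
  "smooth_codim_two W \<longleftrightarrow>
     W \<subseteq> sphere 0 1 \<times> {0..1} \<and>
     (\<forall>(z, t) \<in> W. \<exists>U (h :: C2 \<times> real \<Rightarrow> complex).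
        open U \<and> (z, t) \<in> U \<and> smooth_map_on U h \<and>
        W \<inter> U = {x \<in> U \<inter> (sphere 0 1 \<times> {0..1}). h x = 0} \<and>
        frechet_derivative h (at (z, t)) `
          {(v, s). z \<bullet> v = 0 \<and> (t = 0 \<or> t = 1 \<longrightarrow> s = 0)} = UNIV)"

text \<open>Convergence in the Hausdorff distance.\<close>

definition sets_converge :: "('t \<Rightarrow> 'a::metric_space set) \<Rightarrow> 'a set \<Rightarrow> 't filter \<Rightarrow> bool" where
  "sets_converge A B F \<longleftrightarrow>
     (\<forall>e>0. eventually (\<lambda>t. A t \<subseteq> (\<Union>y\<in>B. ball y e) \<and> B \<subseteq> (\<Union>x\<in>A t. ball x e)) F)"

text \<open>The radial degree of \<open>f t\<close> is left free; the singularity of the link at the parameter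
  \<open>t0\<close> is that its defining equation is not transverse along the limit component \<open>C\<close>.\<close>

definition smooth_elimination_family ::
    "nat \<Rightarrow> nat \<Rightarrow> nat \<Rightarrow> nat \<Rightarrow> (real \<Rightarrow> oriented_link) \<Rightarrow> bool" where
  "smooth_elimination_family p q d r L \<longleftrightarrow>
     (\<exists>f :: real \<Rightarrow> mixed_poly.
        (\<forall>t\<in>{0..1}. L t = oriented_link_of (f t) \<and>
           (\<exists>dr. strongly_polar_weighted_homogeneous p q dr (int (d * p * q)) (f t))) \<and>
        (\<forall>m. smooth_map_on {0..1} (\<lambda>t. Poly_Mapping.lookup (f t) m)) \<and>
        smooth_codim_two {(z, t). t \<in> {0..1} \<and> z \<in> fst (L t)} \<and>
        (\<exists>t0. 0 < t0 \<and> t0 < 1 \<and>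
           (\<forall>t. 0 \<le> t \<and> t < t0 \<longrightarrow> L t \<in> link_space_neg p q d r) \<and>
           (\<forall>t. t0 < t \<and> t \<le> 1 \<longrightarrow> L t \<in> link_space_neg p q d (r - 1)) \<and>
           (\<exists>C \<in> components (fst (L t0)).
              (\<forall>z\<in>C. \<not> transverse_at (f t0) z) \<and>
              (\<exists>A B. (\<forall>t. 0 \<le> t \<and> t < t0 \<longrightarrow>
                        A t \<in> positive_components p q (L t) \<and>
                        B t \<in> negative_components p q (L t)) \<and>
                     sets_converge A C (at_left t0) \<and>
                     sets_converge B C (at_left t0)))))"

end

theory Submission
  imports Defs
begin

text \<open>In the coordinate \<open>w = z\<^sub>1^q / z\<^sub>2^p\<close> of the orbit space, a convenient polynomial of
  polar degree \<open>d * p * q\<close> is a polynomial \<open>\<phi>\<close> in \<open>w\<close> and its conjugate, times a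
  nonvanishing factor; the components of the link are the orbits over the zeros of \<open>\<phi>\<close>, oriented
  by the sign of the Jacobian. So the oriented link depends only on the finite sets \<open>P\<close> and
  \<open>N\<close> of positive and negative zeros, and \<open>f\<close> may be replaced by the product of \<open>w - x\<close> over
  \<open>x \<in> P\<close> and of the conjugates of \<open>w - x\<close> over \<open>x \<in> N\<close>. For \<open>a \<in> P\<close> and \<open>b \<in> N\<close>,
  deform the factor \<open>(w - a) * cnj (w - b)\<close> alone, by adding a multiple of
  \<open>\<bar>w - a\<bar>\<^sup>2 + \<bar>w - b\<bar>\<^sup>2\<close>: its two zeros approach each other along a circular arc
  from \<open>a\<close> to \<open>b\<close>, merge and disappear. A unit constant \<open>\<kappa>\<close> selects one arc in the pencil
  of circles through \<open>a\<close> and \<open>b\<close>; since only finitely many points must be avoided (\<open>0\<close>,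
  \<open>\<infinity>\<close> and the other zeros), a suitable arc exists.\<close>

subsection \<open>Polynomial maps into the complex numbers\<close>

text \<open>The delicate moment is the merging time: the link is singular there, yet the space swept
  out by the links must be smooth. The deformation is affine in \<open>t\<close>, and at a moving
  zero its \<open>t\<close>-derivative is a common nonzero factor times a positive real. At the
  merged zero the spatial differential has rank one and its image is the imaginary axis times the
  same factor, so the \<open>t\<close>-direction supplies the missing dimension. For
  \<open>\<kappa> = 1\<close> that image would collapse to \<open>0\<close>, and the merging point
  would lie at infinity.

  A zero of the deformed factor at \<open>w\<close> forces
  \<open>\<kappa> * (w - a) * cnj (w - b)\<close> to be a nonnegative real. A point other than
  \<open>a\<close> and \<open>b\<close> is therefore hit, at whatever time, for at most one unit
  \<kappa>; this is why one choice of \<kappa> can avoid finitely many points.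

  After the merging the deformed factor is still present. It has no zeros but keeps its degree, so
  the radial degree is constant along the family while two components are lost.\<close>

inductive poly_fun :: "('a::real_normed_vector \<Rightarrow> complex) \<Rightarrow> bool" where
  const: "poly_fun (\<lambda>x. c)"
| lin: "bounded_linear g \<Longrightarrow> poly_fun g"
| add: "poly_fun g \<Longrightarrow> poly_fun h \<Longrightarrow> poly_fun (\<lambda>x. g x + h x)"
| mult: "poly_fun g \<Longrightarrow> poly_fun h \<Longrightarrow> poly_fun (\<lambda>x. g x * h x)"

lemma poly_fun_diff: "poly_fun g \<Longrightarrow> poly_fun h \<Longrightarrow> poly_fun (\<lambda>x. g x - h x)"
  using poly_fun.add[of g "\<lambda>x. (-1) * h x"] poly_fun.mult[OF poly_fun.const[of "-1"], of h] by simp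

lemma poly_fun_power: "poly_fun g \<Longrightarrow> poly_fun (\<lambda>x. g x ^ n)"
  by (induction n) (auto intro: poly_fun.intros)

lemma poly_fun_sum: "(\<And>i. i \<in> I \<Longrightarrow> poly_fun (g i)) \<Longrightarrow> poly_fun (\<lambda>x. \<Sum>i\<in>I. g i x)"
  by (induction I rule: infinite_finite_induct) (auto intro: poly_fun.intros)

lemma poly_fun_prod: "(\<And>i. i \<in> I \<Longrightarrow> poly_fun (g i)) \<Longrightarrow> poly_fun (\<lambda>x. \<Prod>i\<in>I. g i x)"
  by (induction I rule: infinite_finite_induct) (auto intro: poly_fun.intros)

lemma poly_fun_compose_linear:
  assumes "poly_fun g" "bounded_linear l"
  shows "poly_fun (\<lambda>x. g (l x))"
  using assms(1)
proof induction
  case (lin g)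
  then show ?case using assms(2) bounded_linear_compose poly_fun.lin by blast
qed (auto intro: poly_fun.intros)

lemma poly_fun_cnj: "poly_fun g \<Longrightarrow> poly_fun (\<lambda>x. cnj (g x))"
proof (induction rule: poly_fun.induct)
  case (lin g)
  then show ?case using bounded_linear_compose[OF bounded_linear_cnj] poly_fun.lin by blast
qed (auto intro: poly_fun.intros)

text \<open>The second conjunct is the point: the class is closed under directional derivatives, so
  smoothness follows by iterating. Linearity is over the reals, so conjugation and the parameter
  \<open>t\<close> belong to the class as well.\<close>

lemma poly_fun_has_derivative:
  assumes "poly_fun g"
  shows "\<exists>D. (\<forall>x. (g has_derivative D x) (at x)) \<and> (\<forall>v. poly_fun (\<lambda>x. D x v))"
  using assms
proof induction
  case (const c)
  show ?case by (intro exI[of _ "\<lambda>x v. 0"]) (auto intro: poly_fun.const)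
next
  case (lin g)
  then show ?case
    by (intro exI[of _ "\<lambda>x. g"]) (auto intro: poly_fun.const bounded_linear_imp_has_derivative)
next
  case (add g h)
  then obtain D E where "\<forall>x. (g has_derivative D x) (at x)" "\<forall>v. poly_fun (\<lambda>x. D x v)"
    "\<forall>x. (h has_derivative E x) (at x)" "\<forall>v. poly_fun (\<lambda>x. E x v)" by auto
  then show ?case
    by (intro exI[of _ "\<lambda>x v. D x v + E x v"]) (auto intro: poly_fun.intros has_derivative_add)
next
  case (mult g h)
  then obtain D E where "\<forall>x. (g has_derivative D x) (at x)" "\<forall>v. poly_fun (\<lambda>x. D x v)"
    "\<forall>x. (h has_derivative E x) (at x)" "\<forall>v. poly_fun (\<lambda>x. E x v)" by auto
  with mult.hyps show ?case
    by (intro exI[of _ "\<lambda>x v. g x * E x v + D x v * h x"])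
      (auto intro!: poly_fun.add[OF poly_fun.mult poly_fun.mult] intro: has_derivative_mult)
qed

lemma poly_fun_differentiable: "poly_fun g \<Longrightarrow> g differentiable (at x)"
  using poly_fun_has_derivative differentiable_def by blast

lemma poly_fun_frechet:
  assumes "poly_fun g"
  shows "(g has_derivative frechet_derivative g (at x)) (at x)"
    and "poly_fun (\<lambda>x. frechet_derivative g (at x) v)"
proof -
  show *: "(g has_derivative frechet_derivative g (at x)) (at x)" for x
    using poly_fun_differentiable[OF assms] frechet_derivative_works by blast
  obtain D where D: "\<forall>x. (g has_derivative D x) (at x)" "\<forall>v. poly_fun (\<lambda>x. D x v)"
    using poly_fun_has_derivative[OF assms] by blast
  have "frechet_derivative g (at x) = D x" for x
    using D(1) frechet_derivative_at by metis
  then show "poly_fun (\<lambda>x. frechet_derivative g (at x) v)" using D(2) by simp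
qed

lemma poly_fun_smooth:
  fixes g :: "'a::real_normed_vector \<Rightarrow> complex"
  assumes "poly_fun g"
  shows "smooth_map_on S g"
proof -
  define D :: "'a list \<Rightarrow> 'a \<Rightarrow> complex"
    where "D vs = foldr (\<lambda>v h x. frechet_derivative h (at x) v) vs g" for vs
  have "poly_fun (D vs)" for vs
    by (induction vs) (auto simp: D_def assms poly_fun_frechet(2))
  then have "(D vs has_derivative (\<lambda>v. D (v # vs) x)) (at x within S)" for vs x
    using has_derivative_at_withinI[OF poly_fun_frechet(1)] by (fastforce simp: D_def)
  moreover have "D [] x = g x" for x by (simp add: D_def)
  ultimately show ?thesis unfolding smooth_map_on_def by blast
qed

lemma poly_fun_continuous: "poly_fun g \<Longrightarrow> continuous_on S g"
  by (intro continuous_at_imp_continuous_on ballI has_derivative_continuous[OF poly_fun_frechet(1)])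

subsection \<open>Mixed polynomials as a ring\<close>

definition mixed_monom :: "(nat \<times> nat) \<times> (nat \<times> nat) \<Rightarrow> C2 \<Rightarrow> complex" where
  "mixed_monom = (\<lambda>((n1, n2), (m1, m2)) (z1, z2). z1 ^ n1 * z2 ^ n2 * cnj z1 ^ m1 * cnj z2 ^ m2)"

lemma mixed_monom_add: "mixed_monom (k + l) z = mixed_monom k z * mixed_monom l z"
  by (auto simp: mixed_monom_def power_add split: prod.splits)

lemma mixed_monom_0 [simp]: "mixed_monom 0 z = 1"
  by (auto simp: mixed_monom_def zero_prod_def split: prod.splits)

text \<open>Terms may cancel in a sum of polynomials, so evaluations are compared over a common
  larger set of exponents.\<close>

lemma mixed_eval_superset:
  assumes "finite S" "Poly_Mapping.keys f \<subseteq> S"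
  shows "mixed_eval f z = (\<Sum>k\<in>S. Poly_Mapping.lookup f k * mixed_monom k z)"
proof -
  have "mixed_eval f z = (\<Sum>k\<in>Poly_Mapping.keys f. Poly_Mapping.lookup f k * mixed_monom k z)"
    unfolding mixed_eval_def mixed_monom_def by (auto simp: case_prod_beta intro!: sum.cong)
  also have "\<dots> = (\<Sum>k\<in>S. Poly_Mapping.lookup f k * mixed_monom k z)"
    using assms by (intro sum.mono_neutral_left) (auto simp: in_keys_iff)
  finally show ?thesis .
qed

lemma mixed_eval_keys:
  "mixed_eval f z = (\<Sum>k\<in>Poly_Mapping.keys f. Poly_Mapping.lookup f k * mixed_monom k z)"
  by (rule mixed_eval_superset) auto

lemma mixed_eval_add: "mixed_eval (f + g) z = mixed_eval f z + mixed_eval g z"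
proof -
  let ?S = "Poly_Mapping.keys f \<union> Poly_Mapping.keys g"
  have "mixed_eval h z = (\<Sum>k\<in>?S. Poly_Mapping.lookup h k * mixed_monom k z)"
    if "h \<in> {f, g, f + g}" for h
    using that keys_add[of f g] by (intro mixed_eval_superset) auto
  then show ?thesis by (simp add: lookup_add distrib_right sum.distrib)
qed

lemma mixed_eval_single [simp]: "mixed_eval (Poly_Mapping.single k c) z = c * mixed_monom k z"
  by (simp add: mixed_eval_superset[of "{k}"])

lemma mixed_eval_single_mult:
  "mixed_eval (Poly_Mapping.single k c * g) z = c * mixed_monom k z * mixed_eval g z"
proof (induction g rule: update_induct)
  case const
  then show ?case by (simp add: mixed_eval_keys)
next
  case (update f a b)
  have "Poly_Mapping.update a b f = f + Poly_Mapping.single a b"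
    using update by (intro poly_mapping_eqI)
      (auto simp: lookup_update lookup_add lookup_single in_keys_iff)
  with update show ?case
    by (simp add: distrib_left mixed_eval_add mult_single mixed_monom_add algebra_simps)
qed

lemma mixed_eval_mult: "mixed_eval (f * g) z = mixed_eval f z * mixed_eval g z"
proof (induction f rule: update_induct)
  case const
  then show ?case by (simp add: mixed_eval_keys)
next
  case (update f a b)
  have "Poly_Mapping.update a b f = f + Poly_Mapping.single a b"
    using update by (intro poly_mapping_eqI)
      (auto simp: lookup_update lookup_add lookup_single in_keys_iff)
  with update show ?case
    by (simp add: distrib_right mixed_eval_add mixed_eval_single_mult)
qed

lemma mixed_eval_uminus: "mixed_eval (- f) z = - mixed_eval f z"
  using mixed_eval_add[of f "- f" z] by (simp add: mixed_eval_keys[of 0] add_eq_0_iff)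

lemma lookup_scale:
  "Poly_Mapping.lookup (Poly_Mapping.single 0 c * f) k = c * Poly_Mapping.lookup f k"
  for f :: mixed_poly
  by (simp add: mult_map_scale_conv_mult[symmetric] Poly_Mapping.map.rep_eq when_def)

lemma mixed_eval_diff: "mixed_eval (f - g) z = mixed_eval f z - mixed_eval g z"
  using mixed_eval_add[of f "- g" z] by (simp add: mixed_eval_uminus)

lemma mixed_eval_prod: "mixed_eval (\<Prod>i\<in>I. F i) z = (\<Prod>i\<in>I. mixed_eval (F i) z)"
proof (induction I rule: infinite_finite_induct)
  case (infinite A)
  then show ?case using mixed_eval_single[of 0 1 z] by simp
next
  case empty
  then show ?case using mixed_eval_single[of 0 1 z] by simp
qed (simp add: mixed_eval_mult)

lemma poly_fun_mixed_monom: "poly_fun (mixed_monom k)"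
proof -
  obtain n1 n2 m1 m2 where "k = ((n1, n2), (m1, m2))" by (metis surj_pair)
  then have "mixed_monom k = (\<lambda>z. fst z ^ n1 * snd z ^ n2 * cnj (fst z) ^ m1 * cnj (snd z) ^ m2)"
    by (auto simp: mixed_monom_def)
  then show ?thesis
    by (auto intro!: poly_fun.mult poly_fun_power poly_fun_cnj intro: poly_fun.lin
        bounded_linear_fst bounded_linear_snd)
qed

lemma poly_fun_mixed_eval: "poly_fun (mixed_eval f)"
proof -
  have "mixed_eval f = (\<lambda>z. \<Sum>k\<in>Poly_Mapping.keys f. Poly_Mapping.lookup f k * mixed_monom k z)"
    using mixed_eval_keys by blast
  then show ?thesis
    by (auto intro!: poly_fun_sum poly_fun.mult[OF poly_fun.const] poly_fun_mixed_monom)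
qed

subsection \<open>Real linear endomorphisms of the complex numbers\<close>

text \<open>\<open>Im (cnj x * y)\<close> is the oriented area spanned by \<open>x\<close> and
  \<open>y\<close>, so this is the determinant of \<open>T\<close> as a real 2 by 2 matrix.\<close>

definition jac :: "(complex \<Rightarrow> complex) \<Rightarrow> real" where
  "jac T = Im (cnj (T 1) * T \<i>)"

lemma linear_complex_expand:
  assumes "linear T"
  shows "T x = of_real (Re x) * T 1 + of_real (Im x) * T \<i>"
proof -
  have "x = Re x *\<^sub>R 1 + Im x *\<^sub>R \<i>" by (simp add: complex_eq_iff)
  then have "T x = Re x *\<^sub>R T 1 + Im x *\<^sub>R T \<i>"
    by (metis assms linear_add linear_cmul)
  then show ?thesis by (simp add: scaleR_conv_of_real)
qed

lemma jac_area:
  assumes "linear T"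
  shows "Im (cnj (T x) * T y) = jac T * Im (cnj x * y)"
  unfolding jac_def linear_complex_expand[OF assms, of x] linear_complex_expand[OF assms, of y]
  by (simp add: algebra_simps)

lemma jac_scale:
  assumes "linear T"
  shows "jac (\<lambda>\<eta>. c * T (k * \<eta>)) = (cmod c)\<^sup>2 * (cmod k)\<^sup>2 * jac T"
proof -
  have "jac (\<lambda>\<eta>. c * T (k * \<eta>)) = Im ((cnj c * c) * (cnj (T k) * T (k * \<i>)))"
    by (simp add: jac_def algebra_simps)
  also have "\<dots> = (cmod c)\<^sup>2 * Im (cnj (T k) * T (k * \<i>))"
    by (simp add: complex_norm_square[symmetric] mult.commute[of "cnj c"] del: of_real_power)
  also have "\<dots> = (cmod c)\<^sup>2 * (jac T * Im (cnj k * (k * \<i>)))"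
    unfolding jac_area[OF assms] ..
  also have "Im (cnj k * (k * \<i>)) = (cmod k)\<^sup>2"
    unfolding cmod_power2 by (simp add: power2_eq_square)
  finally show ?thesis by simp
qed

text \<open>Holomorphic factors thus give positive zeros and antiholomorphic factors negative
  ones.\<close>

lemma jac_wirtinger: "jac (\<lambda>\<eta>. \<alpha> * \<eta> + \<beta> * cnj \<eta>) = (cmod \<alpha>)\<^sup>2 - (cmod \<beta>)\<^sup>2"
  unfolding jac_def cmod_power2 by (simp add: power2_eq_square algebra_simps)

lemma jac_nonzero_inj:
  assumes "linear T" "jac T \<noteq> 0" "T x = 0"
  shows "x = 0"
proof -
  \<comment> \<open>The area spanned by \<open>x\<close> and \<open>\<i> * x\<close> is the square
    of the modulus of \<open>x\<close>.\<close>
  have "jac T * Im (cnj x * (\<i> * x)) = 0"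
    using jac_area[OF assms(1), of x "\<i> * x"] assms(3) by simp
  with assms(2) have "(Re x)\<^sup>2 + (Im x)\<^sup>2 = 0" by (simp add: power2_eq_square)
  then show ?thesis by (simp add: complex_eq_iff)
qed

lemma jac_nonzero_surj:
  assumes "linear T" "jac T \<noteq> 0"
  obtains x where "T x = y"
proof -
  have "inj T"
    using linear_injective_0[OF assms(1)] jac_nonzero_inj[OF assms] by blast
  then have "surj T" using linear_injective_imp_surjective[OF assms(1)] by blast
  then show ?thesis using that by (metis surjD)
qed

lemma jac_zero_not_surj:
  assumes "linear T" "T x = 1" "T y = \<i>"
  shows "jac T \<noteq> 0"
  using jac_area[OF assms(1), of x y] assms(2,3) by auto

subsection \<open>Determinants\<close>

lemma det_4_vector:
  fixes a :: "real^4"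
  shows "det (vector [a, b, c, d] :: real^4^4) =
    a$1 * (b$2 * (c$3 * d$4 - c$4 * d$3) - b$3 * (c$2 * d$4 - c$4 * d$2) + b$4 * (c$2 * d$3 - c$3 * d$2))
  - a$2 * (b$1 * (c$3 * d$4 - c$4 * d$3) - b$3 * (c$1 * d$4 - c$4 * d$1) + b$4 * (c$1 * d$3 - c$3 * d$1))
  + a$3 * (b$1 * (c$2 * d$4 - c$4 * d$2) - b$2 * (c$1 * d$4 - c$4 * d$1) + b$4 * (c$1 * d$2 - c$2 * d$1))
  - a$4 * (b$1 * (c$2 * d$3 - c$3 * d$2) - b$2 * (c$1 * d$3 - c$3 * d$1) + b$3 * (c$1 * d$2 - c$2 * d$1))"
proof -
  have f4: "finite {2::4, 3, 4}" "1 \<notin> {2::4, 3, 4}" "finite {3::4, 4}" "2 \<notin> {3::4, 4}"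
    "finite {4::4}" "3 \<notin> {4::4}" by auto
  have v: "(vector [a, b, c, d] :: real^4^4) $ 1 = a" "(vector [a, b, c, d] :: real^4^4) $ 2 = b"
     "(vector [a, b, c, d] :: real^4^4) $ 3 = c" "(vector [a, b, c, d] :: real^4^4) $ 4 = d"
    by (simp_all add: vector_def)
  show ?thesis
    unfolding det_def UNIV_4
    unfolding sum_over_permutations_insert[OF f4(1,2)]
    unfolding sum_over_permutations_insert[OF f4(3,4)]
    unfolding sum_over_permutations_insert[OF f4(5,6)]
    unfolding permutes_sing
    by (simp add: sign_swap_id permutation_swap_id permutation_compose sign_compose sign_id
      swap_id_eq v)
 (simp add: algebra_simps)
qed

subsection \<open>Orbits in the three-sphere\<close>

lemma norm_C2_eq_1: "norm (z::C2) = 1 \<longleftrightarrow> (cmod (fst z))\<^sup>2 + (cmod (snd z))\<^sup>2 = 1"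
  by (cases z) (simp add: norm_prod_def)

lemma complex_root_exists:
  assumes "n > 0"
  obtains x :: complex where "x ^ n = w"
proof (cases "w = 0")
  case False
  then have "exp (Ln w / of_nat n) ^ n = w"
    using assms by (simp add: exp_of_nat_mult[symmetric])
  then show ?thesis by (rule that)
qed (use assms that[of 0] in auto)

locale orbit_action =
  fixes p q :: nat
  assumes p_pos: "p > 0" and q_pos: "q > 0" and coprime_pq: "coprime p q"
begin

text \<open>Written without a quotient, so that \<open>z2 = 0\<close> would force
  \<open>z1 = 0\<close>: the singular orbit over infinity never occurs, while \<open>w = 0\<close>
  gives the other singular orbit.\<close>

definition orbit :: "complex \<Rightarrow> C2 set" where
  "orbit w = {z \<in> sphere 0 1. fst z ^ q = w * snd z ^ p}"

definition rotate_by :: "real \<Rightarrow> C2 \<Rightarrow> C2" where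
  "rotate_by \<theta> z = (cis (real p * \<theta>) * fst z, cis (real q * \<theta>) * snd z)"

lemma orbit_snd_nonzero: "z \<in> orbit w \<Longrightarrow> snd z \<noteq> 0"
  using p_pos q_pos by (auto simp: orbit_def norm_C2_eq_1 zero_power)

lemma orbit_fst_nonzero: "z \<in> orbit w \<Longrightarrow> w \<noteq> 0 \<Longrightarrow> fst z \<noteq> 0"
  using orbit_snd_nonzero[of z w] q_pos by (auto simp: orbit_def zero_power)

lemma orbit_ratio: "z \<in> orbit w \<Longrightarrow> fst z ^ q / snd z ^ p = w"
  using orbit_snd_nonzero[of z w] by (auto simp: orbit_def)

lemma orbit_iff:
  "z \<in> sphere 0 1 \<Longrightarrow> snd z \<noteq> 0 \<Longrightarrow> z \<in> orbit w \<longleftrightarrow> fst z ^ q / snd z ^ p = w"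
  by (auto simp: orbit_def divide_eq_eq)

lemma orbit_disjoint: "z \<in> orbit w \<Longrightarrow> z \<in> orbit w' \<Longrightarrow> w = w'"
  using orbit_ratio by blast

lemma dist_rotate_by: "dist (rotate_by \<theta> z) (rotate_by \<theta> z') = dist z z'"
proof -
  have "dist (cis a * x) (cis a * y) = dist x y" for a x y
    by (simp add: dist_norm right_diff_distrib[symmetric] norm_mult)
  then show ?thesis by (simp add: dist_prod_def rotate_by_def)
qed

lemma rotate_by_orbit: "z \<in> orbit w \<Longrightarrow> rotate_by \<theta> z \<in> orbit w"
proof -
  have "cis (real p * \<theta>) ^ q = cis (real q * \<theta>) ^ p" by (simp only: Complex.DeMoivre mult.left_commute)
  then show "z \<in> orbit w \<Longrightarrow> rotate_by \<theta> z \<in> orbit w"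
    by (auto simp: orbit_def norm_C2_eq_1 rotate_by_def norm_mult power_mult_distrib)
qed

text \<open>Taking moduli in the orbit equation, a larger first coordinate forces a larger second
  one, and both points cannot then have norm 1.\<close>

lemma orbit_same_moduli:
  assumes "z \<in> orbit w" "z' \<in> orbit w" "w \<noteq> 0"
  shows "cmod (fst z) = cmod (fst z') \<and> cmod (snd z) = cmod (snd z')"
proof -
  have *: False if "z \<in> orbit w" "z' \<in> orbit w" "cmod (fst z) < cmod (fst z')" for z z'
  proof -
    have w: "cmod (fst z) ^ q = cmod w * cmod (snd z) ^ p" if "z \<in> orbit w" for z
      using that by (auto simp: orbit_def norm_mult[symmetric] norm_power[symmetric])
    have "cmod w * cmod (snd z) ^ p < cmod w * cmod (snd z') ^ p"
      using power_strict_mono[OF that(3) _ q_pos] w[OF that(1)] w[OF that(2)] by simp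
    then have "cmod (snd z) ^ p < cmod (snd z') ^ p"
      using assms(3) by simp
    then have "cmod (snd z) < cmod (snd z')" by (rule power_less_imp_less_base) simp
    then have "(cmod (fst z))\<^sup>2 + (cmod (snd z))\<^sup>2 < (cmod (fst z'))\<^sup>2 + (cmod (snd z'))\<^sup>2"
      using that(3) by (intro add_strict_mono power_strict_mono) auto
    then show False using that(1,2) by (auto simp: orbit_def norm_C2_eq_1)
  qed
  have "cmod (fst z) = cmod (fst z')"
    using *[OF assms(1,2)] *[OF assms(2,1)] by (meson linorder_less_linear)
  moreover from this have "(cmod (snd z))\<^sup>2 = (cmod (snd z'))\<^sup>2"
    using assms(1,2) unfolding orbit_def mem_Collect_eq mem_sphere_0 norm_C2_eq_1
    by (metis add_left_cancel)
  ultimately show ?thesis by (metis norm_ge_zero power2_eq_iff_nonneg)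
qed

text \<open>Equal moduli leave two phases \<alpha>, \<beta>, tied by the orbit equation modulo full
  turns. Coprimality then provides a single rotation parameter that produces both.\<close>

lemma orbit_transitive:
  assumes "z \<in> orbit w" "z' \<in> orbit w" "w \<noteq> 0"
  obtains \<theta> where "z' = rotate_by \<theta> z"
proof -
  have nz: "fst z \<noteq> 0" "snd z \<noteq> 0" "fst z' \<noteq> 0" "snd z' \<noteq> 0"
    using assms orbit_snd_nonzero orbit_fst_nonzero by auto
  have unit: "\<exists>\<alpha>. x' = cis \<alpha> * x" if "cmod x = cmod x'" "x \<noteq> 0" for x x' :: complex
  proof -
    have "x' / x = cis (Arg (x' / x))"
      using that by (subst cis_Arg) (auto simp: sgn_div_norm norm_divide)
    then show ?thesis using that(2) by (metis nonzero_divide_eq_eq)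
  qed
  obtain \<alpha> \<beta> where ab: "fst z' = cis \<alpha> * fst z" "snd z' = cis \<beta> * snd z"
    using unit orbit_same_moduli[OF assms] nz by metis
  have "cis (real p * \<beta>) = cis (real q * \<alpha>)"
  proof -
    have "cis \<alpha> ^ q * fst z ^ q = cis \<beta> ^ p * fst z ^ q"
      using assms(1,2) by (auto simp: orbit_def ab power_mult_distrib)
    then have "cis \<alpha> ^ q = cis \<beta> ^ p" using nz by simp
    then show ?thesis by (simp only: Complex.DeMoivre)
  qed
  then have "exp (\<i> * of_real (real p * \<beta>)) = exp (\<i> * of_real (real q * \<alpha>))"
    unfolding cis_conv_exp .
  then obtain k :: int where "\<i> * of_real (real p * \<beta>) = \<i> * of_real (real q * \<alpha>) + (of_int (2 * k) * pi) * \<i>"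
    unfolding exp_eq by blast
  then have "\<i> * of_real (real p * \<beta>) = \<i> * of_real (real q * \<alpha> + 2 * k * pi)"
    by (simp add: algebra_simps)
  then have k: "real p * \<beta> = real q * \<alpha> + 2 * k * pi"
    by (metis complex_i_not_zero mult_cancel_left of_real_eq_iff)
  obtain x y :: int where "x * int p + y * int q = 1"
    using coprime_pq bezout_int[of "int p" "int q"] by (auto simp: coprime_iff_gcd_eq_1)
  then have xy: "of_int x * real p + of_int y * real q = 1"
    by (metis of_int_1 of_int_add of_int_mult of_int_of_nat_eq)
  \<comment> \<open>With the Bezout coefficients this solves \<open>p * \<theta> = \<alpha>\<close>
    and \<open>q * \<theta> = \<beta>\<close> modulo full turns; the relation \<open>k\<close> makes
    the two congruences compatible.\<close>
  define \<theta> where "\<theta> = x * \<alpha> + y * \<beta>"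
  have "real p * \<theta> = (of_int x * real p) * \<alpha> + y * (real p * \<beta>)"
    by (simp add: \<theta>_def algebra_simps)
  also have "\<dots> = (of_int x * real p + of_int y * real q) * \<alpha> + 2 * pi * of_int (y * k)"
    unfolding k by (simp add: algebra_simps)
  finally have 1: "real p * \<theta> = \<alpha> + 2 * pi * of_int (y * k)" using xy by simp
  have "real q * \<theta> = x * (real q * \<alpha>) + (of_int y * real q) * \<beta>"
    by (simp add: \<theta>_def algebra_simps)
  also have "real q * \<alpha> = real p * \<beta> - 2 * k * pi" using k by simp
  also have "x * (real p * \<beta> - 2 * k * pi) + (of_int y * real q) * \<beta>
      = (of_int x * real p + of_int y * real q) * \<beta> + 2 * pi * of_int (- x * k)"
    by (simp add: algebra_simps)
  finally have 2: "real q * \<theta> = \<beta> + 2 * pi * of_int (- x * k)" using xy by simp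
  have "cis (2 * pi * of_int m) = 1" for m by (rule cis_multiple_2pi) simp
  then have "cis (real p * \<theta>) = cis \<alpha>" "cis (real q * \<theta>) = cis \<beta>"
    unfolding 1 2 cis_mult[symmetric] by (metis mult_1_right)+
  then have "z' = rotate_by \<theta> z" by (simp add: rotate_by_def ab prod_eq_iff)
  then show ?thesis by (rule that)
qed

lemma orbit_eq_range: "z \<in> orbit w \<Longrightarrow> w \<noteq> 0 \<Longrightarrow> orbit w = range (\<lambda>\<theta>. rotate_by \<theta> z)"
  using orbit_transitive rotate_by_orbit by blast

lemma connected_orbit: "w \<noteq> 0 \<Longrightarrow> connected (orbit w)"
proof (cases "orbit w = {}")
  case False
  assume "w \<noteq> 0"
  from False obtain z where "z \<in> orbit w" by blast
  then have "orbit w = range (\<lambda>\<theta>. rotate_by \<theta> z)" using orbit_eq_range \<open>w \<noteq> 0\<close> by blast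
  moreover have "continuous_on UNIV (\<lambda>\<theta>. rotate_by \<theta> z)"
    unfolding rotate_by_def by (intro continuous_intros)
  ultimately show ?thesis by (metis connected_UNIV connected_continuous_image)
qed auto

text \<open>The curve \<open>(r ^ p * \<zeta>, r ^ q)\<close> satisfies the orbit equation for every
  real \<open>r\<close>; its norm grows from 0 to at least 1, so it crosses the sphere.\<close>

lemma orbit_nonempty: "orbit w \<noteq> {}"
proof -
  obtain \<zeta> where \<zeta>: "\<zeta> ^ q = w" using complex_root_exists[OF q_pos] .
  define g where "g r = (r ^ p * cmod \<zeta>)\<^sup>2 + (r ^ q)\<^sup>2" for r :: real
  have "\<exists>r\<ge>0. r \<le> 1 \<and> g r = 1"
  proof (rule IVT')
    show "g 0 \<le> 1" "1 \<le> g 1" using p_pos q_pos by (auto simp: g_def zero_power)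
    show "continuous_on {0..1} g" unfolding g_def by (intro continuous_intros)
  qed auto
  then obtain r where r: "r \<ge> 0" "g r = 1" by blast
  have "(of_real (r ^ p) * \<zeta>, of_real (r ^ q)) \<in> orbit w"
  proof -
    have "(of_real (r ^ p) * \<zeta>) ^ q = w * of_real (r ^ q) ^ p"
      by (simp add: power_mult_distrib \<zeta> power_mult[symmetric] mult.commute[of q p])
    moreover have "norm (of_real (r ^ p) * \<zeta>, of_real (r ^ q) :: complex) = 1"
      using r by (simp add: norm_C2_eq_1 g_def norm_mult norm_power)
    ultimately show ?thesis by (simp add: orbit_def)
  qed
  then show ?thesis by blast
qed

text \<open>Turns the counting of components into the counting of zeros.\<close>

lemma inj_orbit: "inj_on orbit Z"
  using orbit_nonempty orbit_disjoint by (metis ex_in_conv inj_onI)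

text \<open>The continuous function \<open>fst z ^ q / snd z ^ p\<close> takes only finitely many
  values on the union, hence is constant on each connected subset.\<close>

lemma components_orbits:
  assumes "finite Z" "0 \<notin> Z"
  shows "components (\<Union>w\<in>Z. orbit w) = orbit ` Z"
proof -
  let ?U = "\<Union>w\<in>Z. orbit w"
  have *: "\<exists>w\<in>Z. C \<subseteq> orbit w" if C: "C \<noteq> {}" "C \<subseteq> ?U" "connected C" for C
  proof -
    let ?r = "\<lambda>z. fst z ^ q / snd z ^ p"
    have "snd z \<noteq> 0" if "z \<in> C" for z using that C(2) orbit_snd_nonzero by blast
    then have "continuous_on C ?r" by (intro continuous_intros) auto
    then have "connected (?r ` C)" using C(3) by (rule connected_continuous_image)
    moreover have "?r ` C \<subseteq> Z" using C(2) orbit_ratio by auto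
    ultimately obtain w where w: "?r ` C = {w}"
      using C(1) connected_finite_iff_sing[of "?r ` C"] finite_subset[OF _ assms(1)] by auto
    then have "w \<in> Z" using \<open>?r ` C \<subseteq> Z\<close> by blast
    moreover have "C \<subseteq> orbit w"
    proof
      fix z assume "z \<in> C"
      then obtain w' where "z \<in> orbit w'" using C(2) by blast
      moreover have "?r z = w" using w \<open>z \<in> C\<close> by blast
      ultimately show "z \<in> orbit w" using orbit_ratio by metis
    qed
    ultimately show ?thesis by blast
  qed
  show ?thesis
  proof (intro set_eqI iffI)
    fix C assume C: "C \<in> components ?U"
    then have "C \<noteq> {}" "C \<subseteq> ?U" "connected C"
      using in_components_maximal by blast+
    then obtain w where w: "w \<in> Z" "C \<subseteq> orbit w" using * by blast
    then have "orbit w = C"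
      using C assms(2) orbit_nonempty[of w] connected_orbit[of w]
      unfolding in_components_maximal by (metis UN_upper)
    then show "C \<in> orbit ` Z" using w by blast
  next
    fix C assume "C \<in> orbit ` Z"
    then obtain w where w: "w \<in> Z" "C = orbit w" by auto
    have max: "D = C" if D: "D \<noteq> {}" "C \<subseteq> D" "D \<subseteq> ?U" "connected D" for D
    proof -
      obtain w' where w': "w' \<in> Z" "D \<subseteq> orbit w'" using *[OF D(1,3,4)] by blast
      obtain z where "z \<in> orbit w" using orbit_nonempty[of w] by blast
      then have "w = w'" using orbit_disjoint[of z w w'] w(2) D(2) w'(2) by blast
      then show ?thesis using w(2) w'(2) D(2) by blast
    qed
    have "C \<noteq> {}" "C \<subseteq> ?U" "connected C"
      using w assms(2) orbit_nonempty[of w] connected_orbit[of w] by auto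
    with max show "C \<in> components ?U"
      unfolding in_components_maximal by (intro conjI allI impI) (assumption | elim conjE)+
  qed
qed

text \<open>Near the limit orbit by compactness; every point of the limit orbit is then
  reached because the action is isometric and transitive on it.\<close>

lemma orbits_converge:
  assumes "(w \<longlongrightarrow> w0) F" "w0 \<noteq> 0"
  shows "sets_converge (\<lambda>t. orbit (w t)) (orbit w0) F"
  unfolding sets_converge_def
proof (intro allI impI)
  fix e :: real assume "e > 0"
  define N where "N = (\<Union>y\<in>orbit w0. ball y e)"
  define K where "K = sphere 0 1 - N"
  define g where "g z = cmod (fst z ^ q - w0 * snd z ^ p)" for z :: C2
  have cK: "compact K" unfolding K_def N_def by (intro compact_diff compact_sphere open_UN) auto
  have cg: "continuous_on K g" unfolding g_def by (intro continuous_intros)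
  have gpos: "g z > 0" if "z \<in> K" for z
  proof -
    have "z \<notin> orbit w0" using that \<open>e > 0\<close> by (force simp: K_def N_def)
    then show ?thesis using that by (auto simp: g_def K_def orbit_def)
  qed
  \<comment> \<open>The minimum of \<open>g\<close> away from the limit orbit serves as the
    threshold, because \<open>g\<close> is at most \<open>dist v w0\<close> on
    \<open>orbit v\<close>.\<close>
  have "\<exists>\<mu>>0. \<forall>z\<in>K. \<mu> \<le> g z"
  proof (cases "K = {}")
    case False
    then show ?thesis using continuous_attains_inf[OF cK False cg] gpos by blast
  qed (auto intro: exI[of _ 1])
  then obtain \<mu> where \<mu>: "\<mu> > 0" "\<And>z. z \<in> K \<Longrightarrow> \<mu> \<le> g z" by blast
  have sub: "orbit v \<subseteq> N" if "dist v w0 < \<mu>" for v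
  proof
    fix z assume z: "z \<in> orbit v"
    then have "(cmod (snd z))\<^sup>2 \<le> 1" by (auto simp: orbit_def norm_C2_eq_1 intro: order_trans[of _ "1"])
       (smt (verit) zero_le_power2)
    then have le: "cmod (snd z) \<le> 1" by (simp add: power_le_one_iff abs_square_le_1)
    have "g z = cmod ((v - w0) * snd z ^ p)"
      using z by (simp add: g_def orbit_def left_diff_distrib)
    also have "\<dots> \<le> dist v w0 * 1"
      unfolding norm_mult norm_power dist_norm using le by (intro mult_left_mono power_le_one) auto
    finally have "g z < \<mu>" using that by simp
    then show "z \<in> N" using \<mu>(2)[of z] z by (force simp: K_def orbit_def)
  qed
  have sup: "orbit w0 \<subseteq> (\<Union>x\<in>orbit v. ball x e)" if sv: "orbit v \<subseteq> N" for v
  proof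
    fix z' assume z': "z' \<in> orbit w0"
    obtain z where z: "z \<in> orbit v" using orbit_nonempty by blast
    then obtain y where y: "y \<in> orbit w0" "dist y z < e" using sv by (auto simp: N_def)
    obtain \<theta> where th: "z' = rotate_by \<theta> y" using orbit_transitive[OF y(1) z' assms(2)] .
    then have "dist (rotate_by \<theta> z) z' < e" using y(2) by (simp add: dist_rotate_by dist_commute)
    then show "z' \<in> (\<Union>x\<in>orbit v. ball x e)" using rotate_by_orbit[OF z] by auto
  qed
  have "eventually (\<lambda>t. dist (w t) w0 < \<mu>) F" using assms(1) \<mu>(1) by (rule tendstoD)
  then show "eventually (\<lambda>t. orbit (w t) \<subseteq> (\<Union>y\<in>orbit w0. ball y e) \<and>
      orbit w0 \<subseteq> (\<Union>x\<in>orbit (w t). ball x e)) F"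
    by eventually_elim (use sub sup in \<open>auto simp: N_def\<close>)
qed

end

subsection \<open>Mixed polynomials in the orbit coordinate\<close>

lemma real_coords_nth:
  "real_coords z $ 1 = Re (fst z)" "real_coords z $ 2 = Im (fst z)"
  "real_coords z $ 3 = Re (snd z)" "real_coords z $ 4 = Im (snd z)"
  by (simp_all add: real_coords_def vector_def)

text \<open>Multiples of the tangent vector may be removed from the two transverse vectors, which
  leaves only their components normal to the orbit.\<close>

lemma det4_shear:
  "det4 a (b + x *\<^sub>R d) (c + y *\<^sub>R d) (k *\<^sub>R d) = k * det4 a b c d"
  by (simp add: det4_def det_4_vector real_coords_nth algebra_simps)

text \<open>At a zero the injective differential is bounded below, so no other zero is nearby; a
  compact set without accumulation points of its own is finite.\<close>

lemma finite_zeros: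
  assumes "poly_fun \<phi>" and jac: "\<And>w. \<phi> w = 0 \<Longrightarrow> jac (frechet_derivative \<phi> (at w)) \<noteq> 0"
    and "compact {w. \<phi> w = 0}"
  shows "finite {w. \<phi> w = 0}"
proof -
  have "\<not> w islimpt {w. \<phi> w = 0}" if w: "\<phi> w = 0" for w
  proof
    let ?D = "frechet_derivative \<phi> (at w)"
    assume lim: "w islimpt {w. \<phi> w = 0}"
    have der: "(\<phi> has_derivative ?D) (at w)" by (rule poly_fun_frechet(1)[OF assms(1)])
    then have lin: "linear ?D" by (rule has_derivative_linear)
    then have "inj ?D"
      using linear_injective_0[OF lin] jac_nonzero_inj[OF lin jac[OF w]] by blast
    then obtain B where B: "B > 0" "\<And>x. B * norm x \<le> norm (?D x)"
      using linear_inj_bounded_below_pos[OF lin] by blast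
    obtain \<delta> where \<delta>: "\<delta> > 0"
        "\<And>y. norm (y - w) < \<delta> \<Longrightarrow> norm (\<phi> y - \<phi> w - ?D (y - w)) \<le> B / 2 * norm (y - w)"
      using der B(1) unfolding has_derivative_at_alt by (meson half_gt_zero)
    obtain y where y: "\<phi> y = 0" "y \<noteq> w" "dist y w < \<delta>"
      using lim \<delta>(1) unfolding islimpt_approachable by blast
    have "B * norm (y - w) \<le> B / 2 * norm (y - w)"
      using \<delta>(2)[of y] y B(2)[of "y - w"] w by (simp add: dist_norm)
    then show False using B(1) y(2) by simp
  qed
  then show ?thesis
    using finite_not_islimpt_in_compact[OF assms(3), of "{w. \<phi> w = 0}"] by simp
qed

context orbit_action
begin

text \<open>\<open>\<phi>\<close> is \<open>f\<close> in the coordinate \<open>w = z\<^sub>1^q / z\<^sub>2^p\<close> of the orbit space; no component of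
  the link is a singular orbit.\<close>

definition models :: "nat \<Rightarrow> nat \<Rightarrow> mixed_poly \<Rightarrow> (complex \<Rightarrow> complex) \<Rightarrow> bool" where
  "models n m f \<phi> \<longleftrightarrow> poly_fun \<phi> \<and> \<phi> 0 \<noteq> 0 \<and> (\<forall>x. x \<noteq> 0 \<longrightarrow> mixed_eval f (x, 0) \<noteq> 0) \<and>
     (\<forall>z. snd z \<noteq> 0 \<longrightarrow>
        mixed_eval f z = (snd z ^ p) ^ n * cnj (snd z ^ p) ^ m * \<phi> (fst z ^ q / snd z ^ p))"

text \<open>The complex linear form whose kernel is the complex tangent of the orbit through \<open>z\<close>.\<close>

definition normal_form :: "C2 \<Rightarrow> C2 \<Rightarrow> complex" where
  "normal_form z v = of_nat q * snd z * fst v - of_nat p * fst z * snd v"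

text \<open>The normal form of an oriented link. All positive multiples of the velocity are listed
  because an oriented link stores every positive tangent vector.\<close>

definition orbit_link :: "complex set \<Rightarrow> complex set \<Rightarrow> oriented_link" where
  "orbit_link P N = (\<Union>w\<in>P \<union> N. orbit w,
     {(z, v). (\<exists>w\<in>P. z \<in> orbit w \<and> (\<exists>c>0. v = c *\<^sub>R orbit_velocity p q z)) \<or>
              (\<exists>w\<in>N. z \<in> orbit w \<and> (\<exists>c>0. v = - (c *\<^sub>R orbit_velocity p q z)))})"

lemma orbit_velocity_nonzero: "z \<in> orbit w \<Longrightarrow> orbit_velocity p q z \<noteq> 0"
  using orbit_snd_nonzero[of z w] q_pos by (simp add: orbit_velocity_def prod_eq_iff)

lemma models_eval:
  "models n m f \<phi> \<Longrightarrow> snd z \<noteq> 0 \<Longrightarrow>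
    mixed_eval f z = (snd z ^ p) ^ n * cnj (snd z ^ p) ^ m * \<phi> (fst z ^ q / snd z ^ p)"
  unfolding models_def by blast

lemma link_of_models: "models n m f \<phi> \<Longrightarrow> link_of f = (\<Union>w\<in>{w. \<phi> w = 0}. orbit w)"
proof (intro set_eqI iffI)
  fix z assume m: "models n m f \<phi>" and "z \<in> link_of f"
  then have z: "z \<in> sphere 0 1" "mixed_eval f z = 0" by (auto simp: link_of_def)
  have "snd z \<noteq> 0"
  proof
    assume "snd z = 0"
    moreover from this have "fst z \<noteq> 0" using z(1) by (auto simp: norm_C2_eq_1)
    ultimately show False using m z(2) unfolding models_def by (metis prod.collapse)
  qed
  moreover from this have "\<phi> (fst z ^ q / snd z ^ p) = 0"
    using models_eval[OF m, of z] z(2) by simp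
  ultimately show "z \<in> (\<Union>w\<in>{w. \<phi> w = 0}. orbit w)" using orbit_iff[OF z(1)] by blast
next
  fix z assume m: "models n m f \<phi>" and "z \<in> (\<Union>w\<in>{w. \<phi> w = 0}. orbit w)"
  then obtain w where "\<phi> w = 0" "z \<in> orbit w" by blast
  then show "z \<in> link_of f"
    using models_eval[OF m, of z] orbit_ratio[of z w] orbit_snd_nonzero[of z w]
    by (auto simp: link_of_def orbit_def)
qed

text \<open>Logarithmic differentiation: \<open>dw / w = q * dz1 / z1 - p * dz2 / z2\<close>,
  brought to a common denominator.\<close>

lemma ratio_has_derivative:
  assumes "fst z \<noteq> 0" "snd z \<noteq> 0"
  shows "((\<lambda>z. fst z ^ q / snd z ^ p) has_derivative
     (\<lambda>v. fst z ^ q / snd z ^ p / (fst z * snd z) * normal_form z v)) (at z)"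
proof -
  \<comment> \<open>Writing \<open>x ^ n / x\<close> avoids the truncated exponent
    \<open>n - 1\<close> and leaves the common factor visible.\<close>
  have pw: "((\<lambda>x. x ^ n) has_derivative (\<lambda>h. of_nat n * x ^ n / x * h)) (at x)"
    if "x \<noteq> 0" for x :: complex and n
  proof -
    have "of_nat n * x ^ n / x = of_nat n * x ^ (n - Suc 0)"
      using that by (cases n) auto
    moreover have "((\<lambda>x. x ^ n) has_field_derivative of_nat n * x ^ (n - Suc 0)) (at x)"
      by (auto intro!: derivative_eq_intros)
    ultimately show ?thesis by (simp add: has_field_derivative_def)
  qed
  have 1: "((\<lambda>z. fst z ^ q) has_derivative (\<lambda>v. of_nat q * fst z ^ q / fst z * fst v)) (at z)"
    using has_derivative_compose[OF has_derivative_fst[OF has_derivative_ident] pw[OF assms(1)]] by simp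
  have 2: "((\<lambda>z. snd z ^ p) has_derivative (\<lambda>v. of_nat p * snd z ^ p / snd z * snd v)) (at z)"
    using has_derivative_compose[OF has_derivative_snd[OF has_derivative_ident] pw[OF assms(2)]] by simp
  show ?thesis
    by (rule has_derivative_eq_rhs[OF has_derivative_divide'[OF 1 2]])
      (use assms in \<open>auto simp: normal_form_def field_simps power2_eq_square\<close>)
qed

text \<open>Because \<open>\<phi> w = 0\<close>, the term containing the derivative of the prefactor
  drops out of the product rule.\<close>

lemma models_has_derivative:
  assumes "models n m f \<phi>" "fst z \<noteq> 0" "snd z \<noteq> 0" and w: "w = fst z ^ q / snd z ^ p" "\<phi> w = 0"
  shows "(mixed_eval f has_derivative
    (\<lambda>v. (snd z ^ p) ^ n * cnj (snd z ^ p) ^ m *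
      frechet_derivative \<phi> (at w) (w / (fst z * snd z) * normal_form z v))) (at z)"
proof -
  let ?g = "\<lambda>z :: C2. (snd z ^ p) ^ n * cnj (snd z ^ p) ^ m"
  let ?h = "\<lambda>z :: C2. \<phi> (fst z ^ q / snd z ^ p)"
  have "poly_fun ?g"
    by (intro poly_fun.mult poly_fun_power poly_fun_cnj poly_fun.lin bounded_linear_snd)
  then have g: "(?g has_derivative frechet_derivative ?g (at z)) (at z)"
    by (rule poly_fun_frechet(1))
  have "(\<phi> has_derivative frechet_derivative \<phi> (at w)) (at w)"
    using assms(1) by (intro poly_fun_frechet(1)) (simp add: models_def)
  from has_derivative_compose[OF ratio_has_derivative[OF assms(2,3)] this[unfolded w(1)]]
  have h: "(?h has_derivative
      (\<lambda>v. frechet_derivative \<phi> (at w) (w / (fst z * snd z) * normal_form z v))) (at z)"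
    by (simp add: w(1))
  have op: "open {z :: C2. snd z \<noteq> 0}"
    by (intro open_Collect_neq continuous_intros)
  have der: "((\<lambda>z. ?g z * ?h z) has_derivative
    (\<lambda>v. (snd z ^ p) ^ n * cnj (snd z ^ p) ^ m *
      frechet_derivative \<phi> (at w) (w / (fst z * snd z) * normal_form z v))) (at z)"
    by (rule has_derivative_eq_rhs[OF has_derivative_mult[OF g h]]) (use w in auto)
  show ?thesis
    by (rule has_derivative_transform_within_open[OF der op])
      (use assms(3) models_eval[OF assms(1)] in auto)
qed

section \<open>Frames along a regular orbit and the sign of its orientation\<close>

lemma normal_form_linear: "linear (normal_form z)"
  by (rule linearI) (auto simp: normal_form_def algebra_simps scaleR_conv_of_real)

text \<open>Spans the Hermitian complement of \<open>z\<close>: all its complex multiples are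
  tangent to the sphere.\<close>

definition normal_field :: "C2 \<Rightarrow> C2" where
  "normal_field z = (cnj (snd z), - cnj (fst z))"

definition orbit_speed :: "C2 \<Rightarrow> real" where
  "orbit_speed z = q * (cmod (snd z))\<^sup>2 + p * (cmod (fst z))\<^sup>2"

lemma orbit_speed_pos: "snd z \<noteq> 0 \<Longrightarrow> orbit_speed z > 0"
  using q_pos by (auto simp: orbit_speed_def intro!: add_pos_nonneg)

lemma normal_form_field:
  "normal_form z (\<omega> * fst (normal_field z), \<omega> * snd (normal_field z)) = of_real (orbit_speed z) * \<omega>"
  by (simp add: normal_form_def normal_field_def orbit_speed_def algebra_simps complex_norm_square
      del: of_real_power)

lemma inner_normal_field: "z \<bullet> (\<omega> * fst (normal_field z), \<omega> * snd (normal_field z)) = 0"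
  by (cases z) (simp add: normal_field_def inner_complex_def algebra_simps)

lemma normal_form_surj:
  assumes "snd z \<noteq> 0"
  obtains v where "z \<bullet> v = 0" "normal_form z v = \<omega>"
  using inner_normal_field normal_form_field[of z "\<omega> / of_real (orbit_speed z)"]
    orbit_speed_pos[OF assms] that by (metis less_irrefl nonzero_eq_divide_eq mult.commute of_real_eq_0_iff)

lemma orbit_velocity_tangent:
  "z \<bullet> orbit_velocity p q z = 0" "normal_form z (orbit_velocity p q z) = 0"
  by (cases z; simp add: orbit_velocity_def normal_form_def inner_complex_def algebra_simps)+

text \<open>The kernel of the complex form is the complex line through
  \<open>(p * z1, q * z2)\<close>. Tangency to the sphere kills the real part of the multiplier,
  which leaves real multiples of the velocity.\<close>

lemma normal_form_kernel:
  assumes "fst z \<noteq> 0" "snd z \<noteq> 0" "z \<bullet> v = 0" "normal_form z v = 0"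
  obtains c where "v = c *\<^sub>R orbit_velocity p q z"
proof -
  define \<mu> where "\<mu> = fst v / (of_nat p * fst z)"
  have v: "fst v = \<mu> * of_nat p * fst z" "snd v = \<mu> * of_nat q * snd z"
    using assms p_pos by (auto simp: \<mu>_def normal_form_def field_simps)
  have "z \<bullet> v = Re \<mu> * (p * (cmod (fst z))\<^sup>2 + q * (cmod (snd z))\<^sup>2)"
    unfolding inner_prod_def inner_complex_def v cmod_power2
    by (simp add: algebra_simps power2_eq_square)
  moreover have "p * (cmod (fst z))\<^sup>2 + q * (cmod (snd z))\<^sup>2 > 0"
    using assms(2) q_pos by (intro add_nonneg_pos) auto
  ultimately have "Re \<mu> = 0" using assms(3) by auto
  then obtain x where "\<mu> = of_real x * \<i>"
    by (metis complex_eq mult.commute add_0 of_real_0)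
  then have "v = x *\<^sub>R orbit_velocity p q z"
    by (intro prod_eqI) (simp_all add: v orbit_velocity_def scaleR_conv_of_real)
  then show ?thesis by (rule that)
qed

text \<open>Fixes the sign convention: the sphere normal, a positive frame of the normal plane and
  the orbit velocity form a positive basis.\<close>

lemma det4_normal_field:
  "det4 z (\<omega>1 * fst (normal_field z), \<omega>1 * snd (normal_field z))
      (\<omega>2 * fst (normal_field z), \<omega>2 * snd (normal_field z)) (orbit_velocity p q z)
    = Im (cnj \<omega>1 * \<omega>2) * ((norm z)\<^sup>2 * (p * (cmod (fst z))\<^sup>2 + q * (cmod (snd z))\<^sup>2))"
proof (cases z)
  case (Pair x y)
  show ?thesis
    unfolding Pair norm_Pair cmod_power2
    by (simp add: det4_def det_4_vector real_coords_nth normal_field_def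
        orbit_velocity_def cmod_power2) (simp add: algebra_simps power2_eq_square)
qed

lemma det4_tangent:
  assumes "fst z \<noteq> 0" "snd z \<noteq> 0" "z \<bullet> w1 = 0" "z \<bullet> w2 = 0"
  shows "\<exists>K>0. det4 z w1 w2 (c *\<^sub>R orbit_velocity p q z)
    = c * K * Im (cnj (normal_form z w1) * normal_form z w2)"
proof -
  let ?n = "\<lambda>\<omega>. (\<omega> * fst (normal_field z), \<omega> * snd (normal_field z))"
  let ?S = "orbit_speed z"
  have S: "?S > 0" by (rule orbit_speed_pos[OF assms(2)])
  \<comment> \<open>Splits a sphere tangent vector into its normal component and a multiple of the
    velocity; the latter is sheared away below.\<close>
  have dec: "\<exists>x. w = ?n (normal_form z w / ?S) + x *\<^sub>R orbit_velocity p q z"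
    if "z \<bullet> w = 0" for w
  proof -
    let ?d = "w - ?n (normal_form z w / ?S)"
    have "z \<bullet> ?d = 0"
      using that inner_normal_field by (simp only: inner_diff_right diff_self)
    moreover have "normal_form z ?d = 0"
      unfolding linear_diff[OF normal_form_linear] normal_form_field using S by simp
    ultimately obtain x where "?d = x *\<^sub>R orbit_velocity p q z"
      using normal_form_kernel[OF assms(1,2)] by blast
    then show ?thesis by (metis add.commute diff_add_cancel)
  qed
  let ?a = "normal_form z w1 / ?S" and ?b = "normal_form z w2 / ?S"
  obtain x y where xy: "w1 = ?n ?a + x *\<^sub>R orbit_velocity p q z"
      "w2 = ?n ?b + y *\<^sub>R orbit_velocity p q z"
    using dec[OF assms(3)] dec[OF assms(4)] by blast
  have "det4 z w1 w2 (c *\<^sub>R orbit_velocity p q z)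
    = det4 z (?n ?a + x *\<^sub>R orbit_velocity p q z) (?n ?b + y *\<^sub>R orbit_velocity p q z)
        (c *\<^sub>R orbit_velocity p q z)"
    by (simp only: xy[symmetric])
  also have "\<dots> = c * (Im (cnj ?a * ?b) *
      ((norm z)\<^sup>2 * (p * (cmod (fst z))\<^sup>2 + q * (cmod (snd z))\<^sup>2)))"
    unfolding det4_shear det4_normal_field ..
  also have "cnj ?a * ?b = (cnj (normal_form z w1) * normal_form z w2) / of_real (?S\<^sup>2)"
    by (simp add: power2_eq_square)
  also have "Im \<dots> = Im (cnj (normal_form z w1) * normal_form z w2) / ?S\<^sup>2"
    by (rule Im_divide_of_real)
  finally have "det4 z w1 w2 (c *\<^sub>R orbit_velocity p q z)
    = c * ((norm z)\<^sup>2 * (p * (cmod (fst z))\<^sup>2 + q * (cmod (snd z))\<^sup>2) / ?S\<^sup>2)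
        * Im (cnj (normal_form z w1) * normal_form z w2)"
    by simp
  moreover have "(norm z)\<^sup>2 * (p * (cmod (fst z))\<^sup>2 + q * (cmod (snd z))\<^sup>2) / ?S\<^sup>2 > 0"
    using S assms(2) q_pos by (intro divide_pos_pos mult_pos_pos add_nonneg_pos) auto
  ultimately show ?thesis by blast
qed

text \<open>\<open>M\<close> carries the normal coordinates of \<open>w1\<close> and
  \<open>w2\<close> to \<open>1\<close> and \<i>, so their oriented area is
  \<open>1 / jac M\<close>. Hence the determinant for \<open>c\<close> times the velocity has the
  sign of \<open>c * jac M\<close>.\<close>

lemma positive_tangent_iff:
  assumes z: "fst z \<noteq> 0" "snd z \<noteq> 0"
    and der: "(mixed_eval f has_derivative (\<lambda>v. M (normal_form z v))) (at z)"
    and M: "linear M" "jac M \<noteq> 0"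
  shows "positive_tangent f z v \<longleftrightarrow> (\<exists>c>0. v = (c * sgn (jac M)) *\<^sub>R orbit_velocity p q z)"
proof -
  have D: "frechet_derivative (mixed_eval f) (at z) = (\<lambda>v. M (normal_form z v))"
    using der frechet_derivative_at by metis
  have sign: "c * jac M > 0 \<longleftrightarrow> det4 z w1 w2 (c *\<^sub>R orbit_velocity p q z) > 0"
    if w: "z \<bullet> w1 = 0" "z \<bullet> w2 = 0" "M (normal_form z w1) = 1" "M (normal_form z w2) = \<i>" for c w1 w2
  proof -
    obtain K where K: "K > 0" "det4 z w1 w2 (c *\<^sub>R orbit_velocity p q z)
        = c * K * Im (cnj (normal_form z w1) * normal_form z w2)"
      using det4_tangent[OF z w(1,2)] by blast
    have "jac M * Im (cnj (normal_form z w1) * normal_form z w2) = 1"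
      using jac_area[OF M(1), of "normal_form z w1" "normal_form z w2"] w(3,4) by simp
    then have im: "Im (cnj (normal_form z w1) * normal_form z w2) = 1 / jac M"
      using M(2) by (simp add: field_simps)
    have "det4 z w1 w2 (c *\<^sub>R orbit_velocity p q z) = c * jac M * (K / (jac M)\<^sup>2)"
      unfolding K(2) im using M(2) by (simp add: power2_eq_square)
    moreover have "K / (jac M)\<^sup>2 > 0" using K(1) M(2) by simp
    ultimately show ?thesis by (metis mult_pos_pos zero_less_mult_pos2)
  qed
  have pt: "positive_tangent f z v \<longleftrightarrow> z \<bullet> v = 0 \<and> M (normal_form z v) = 0 \<and>
     (\<exists>w1 w2. z \<bullet> w1 = 0 \<and> z \<bullet> w2 = 0 \<and> M (normal_form z w1) = 1 \<and> M (normal_form z w2) = \<i> \<and>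
        det4 z w1 w2 v > 0)" for v
    by (simp add: positive_tangent_def D Let_def)
  show ?thesis
  proof
    assume "positive_tangent f z v"
    then obtain w1 w2 where w: "z \<bullet> v = 0" "M (normal_form z v) = 0"
      "z \<bullet> w1 = 0" "z \<bullet> w2 = 0" "M (normal_form z w1) = 1" "M (normal_form z w2) = \<i>"
      "det4 z w1 w2 v > 0" unfolding pt by blast
    obtain c where c: "v = c *\<^sub>R orbit_velocity p q z"
      using normal_form_kernel[OF z w(1)] jac_nonzero_inj[OF M w(2)] by blast
    then have "c * jac M > 0" using sign[OF w(3-6)] w(7) by blast
    then have "\<bar>c\<bar> > 0" "c = \<bar>c\<bar> * sgn (jac M)"
      by (auto simp: zero_less_mult_iff abs_if)
    then show "\<exists>c>0. v = (c * sgn (jac M)) *\<^sub>R orbit_velocity p q z" using c by metis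
  next
    assume "\<exists>c>0. v = (c * sgn (jac M)) *\<^sub>R orbit_velocity p q z"
    then obtain c where c: "c > 0" "v = (c * sgn (jac M)) *\<^sub>R orbit_velocity p q z" by blast
    obtain \<omega>1 \<omega>2 where "M \<omega>1 = 1" "M \<omega>2 = \<i>" using jac_nonzero_surj[OF M] by metis
    then obtain w1 w2 where w: "z \<bullet> w1 = 0" "z \<bullet> w2 = 0"
      "M (normal_form z w1) = 1" "M (normal_form z w2) = \<i>"
      using normal_form_surj[OF z(2)] by metis
    have "(c * sgn (jac M)) * jac M > 0" using c(1) M(2) by (simp add: mult.assoc abs_sgn[symmetric] mult.commute[of "sgn _"])
    then have "det4 z w1 w2 v > 0" using sign[OF w] c(2) by blast
    moreover have "z \<bullet> v = 0" "M (normal_form z v) = 0"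
      by (simp_all add: c(2) orbit_velocity_tangent linear_cmul[OF normal_form_linear] linear_0[OF M(1)])
    ultimately show "positive_tangent f z v" unfolding pt using w by blast
  qed
qed

text \<open>Passing from \<phi> to \<open>f\<close> only multiplies by nonzero complex numbers
  before and after the differential. These preserve orientation, so the sign of the Jacobian is that
  of \<phi>.\<close>

lemma models_normal_map:
  assumes "models n m f \<phi>" "fst z \<noteq> 0" "snd z \<noteq> 0" "w = fst z ^ q / snd z ^ p" "\<phi> w = 0"
  obtains M where "linear M" "(mixed_eval f has_derivative (\<lambda>v. M (normal_form z v))) (at z)"
    "sgn (jac M) = sgn (jac (frechet_derivative \<phi> (at w)))"
proof -
  let ?c = "(snd z ^ p) ^ n * cnj (snd z ^ p) ^ m" and ?k = "w / (fst z * snd z)"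
  let ?D = "frechet_derivative \<phi> (at w)"
  define M where "M \<eta> = ?c * ?D (?k * \<eta>)" for \<eta>
  have "linear ?D"
    using poly_fun_frechet(1) assms(1) has_derivative_linear unfolding models_def by blast
  then have "linear M"
    unfolding M_def linear_iff by (simp add: distrib_left linear_add linear_cmul)
  moreover have "(mixed_eval f has_derivative (\<lambda>v. M (normal_form z v))) (at z)"
    unfolding M_def by (rule models_has_derivative[OF assms])
  moreover have "sgn (jac M) = sgn (jac ?D)"
  proof -
    have pos: "sgn (x * y) = sgn y" if "x > 0" for x y :: real using that by (simp add: sgn_mult)
    have sq: "(cmod a)\<^sup>2 > 0" if "a \<noteq> 0" for a using that by simp
    have "?c \<noteq> 0" "?k \<noteq> 0" using assms by auto
    then have "(cmod ?c)\<^sup>2 * (cmod ?k)\<^sup>2 > 0"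
      using mult_pos_pos[OF sq sq] by blast
    then show ?thesis
      unfolding M_def jac_scale[OF \<open>linear ?D\<close>] by (rule pos)
  qed
  ultimately show ?thesis by (rule that)
qed

section \<open>Oriented links as signed sets of orbits\<close>

lemma orbit_link_tangent:
  assumes "z \<in> orbit w"
  shows "(z, v) \<in> snd (orbit_link P N) \<longleftrightarrow>
    w \<in> P \<and> (\<exists>c>0. v = c *\<^sub>R orbit_velocity p q z) \<or>
    w \<in> N \<and> (\<exists>c>0. v = - (c *\<^sub>R orbit_velocity p q z))"
proof -
  have "(\<exists>w'\<in>X. z \<in> orbit w' \<and> Q) \<longleftrightarrow> w \<in> X \<and> Q" for X Q
    using assms orbit_disjoint[OF _ assms] by blast
  then show ?thesis by (simp add: orbit_link_def)
qed

text \<open>The degrees \<open>n\<close>, \<open>m\<close> and the prefactor leave no trace: only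
  the zeros of \<phi> and their signs enter. This is what permits replacing the given
  polynomial.\<close>

lemma oriented_link_of_models:
  assumes "models n m f \<phi>"
    and jac: "\<And>w. \<phi> w = 0 \<Longrightarrow> jac (frechet_derivative \<phi> (at w)) \<noteq> 0"
  shows "oriented_link_of f = orbit_link
     {w. \<phi> w = 0 \<and> jac (frechet_derivative \<phi> (at w)) > 0}
     {w. \<phi> w = 0 \<and> jac (frechet_derivative \<phi> (at w)) < 0}" (is "_ = orbit_link ?P ?N")
proof -
  have PN: "?P \<union> ?N = {w. \<phi> w = 0}" using jac by (auto simp: linorder_neq_iff)
  then have link: "link_of f = (\<Union>w\<in>?P \<union> ?N. orbit w)"
    using link_of_models[OF assms(1)] by simp
  have pt: "positive_tangent f z v \<longleftrightarrow>
      (\<exists>c>0. v = (c * sgn (jac (frechet_derivative \<phi> (at w)))) *\<^sub>R orbit_velocity p q z)"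
    if z: "z \<in> orbit w" "\<phi> w = 0" for z w v
  proof -
    have "w \<noteq> 0" using z(2) assms(1) by (auto simp: models_def)
    then have nz: "fst z \<noteq> 0" "snd z \<noteq> 0" using orbit_fst_nonzero orbit_snd_nonzero z by auto
    obtain M where M: "linear M" "(mixed_eval f has_derivative (\<lambda>v. M (normal_form z v))) (at z)"
      "sgn (jac M) = sgn (jac (frechet_derivative \<phi> (at w)))"
      using models_normal_map[OF assms(1) nz orbit_ratio[OF z(1), symmetric] z(2)] .
    then have "jac M \<noteq> 0" using jac[OF z(2)] by (metis sgn_0_0)
    then show ?thesis using positive_tangent_iff[OF nz M(2,1)] M(3) by simp
  qed
  have "(z, v) \<in> snd (oriented_link_of f) \<longleftrightarrow> (z, v) \<in> snd (orbit_link ?P ?N)" for z v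
  proof (cases "z \<in> link_of f")
    case True
    then obtain w where w: "z \<in> orbit w" "\<phi> w = 0" unfolding link_of_models[OF assms(1)] by auto
    have "(z, v) \<in> snd (oriented_link_of f) \<longleftrightarrow> positive_tangent f z v"
      using True by (simp add: oriented_link_of_def)
    also have "\<dots> \<longleftrightarrow> (z, v) \<in> snd (orbit_link ?P ?N)"
    proof (cases "jac (frechet_derivative \<phi> (at w)) > 0")
      case True
      then have "w \<in> ?P" "w \<notin> ?N" using w by auto
      then show ?thesis unfolding pt[OF w] orbit_link_tangent[OF w(1)] using True by simp
    next
      case False
      then have "jac (frechet_derivative \<phi> (at w)) < 0" using jac[OF w(2)] by linarith
      moreover from this have "w \<notin> ?P" "w \<in> ?N" using w by auto
      ultimately show ?thesis unfolding pt[OF w] orbit_link_tangent[OF w(1)] by simp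
    qed
    finally show ?thesis .
  next
    case False
    then show ?thesis unfolding link by (auto simp: oriented_link_of_def orbit_link_def link)
  qed
  then have "snd (oriented_link_of f) = snd (orbit_link ?P ?N)" by auto
  moreover have "fst (oriented_link_of f) = fst (orbit_link ?P ?N)"
    using link by (simp add: oriented_link_of_def orbit_link_def)
  ultimately show ?thesis by (simp add: prod_eq_iff)
qed

lemma components_orbit_link:
  assumes "finite P" "finite N" "0 \<notin> P \<union> N"
  shows "components (fst (orbit_link P N)) = orbit ` (P \<union> N)"
  using components_orbits[of "P \<union> N"] assms by (simp add: orbit_link_def)

text \<open>The velocity is nonzero, so it is no negative multiple of itself and the two
  orientations of an orbit are never confused.\<close>

lemma signed_components_orbit_link:
  assumes "finite P" "finite N" "0 \<notin> P \<union> N" "P \<inter> N = {}"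
  shows "positive_components p q (orbit_link P N) = orbit ` P"
    and "negative_components p q (orbit_link P N) = orbit ` N"
proof -
  let ?v = "orbit_velocity p q" and ?T = "snd (orbit_link P N)"
  have T: "(z, ?v z) \<in> ?T \<longleftrightarrow> w \<in> P" "(z, - ?v z) \<in> ?T \<longleftrightarrow> w \<in> N"
    if z: "z \<in> orbit w" for z w
  proof -
    have 1: "(\<exists>c>0. ?v z = c *\<^sub>R ?v z)" "(\<exists>c>0. - ?v z = - (c *\<^sub>R ?v z))"
      by (rule exI[of _ 1]; simp)+
    have "?v z \<noteq> - (c *\<^sub>R ?v z) \<and> - ?v z \<noteq> c *\<^sub>R ?v z" if "c > 0" for c
    proof -
      have "(1 + c) *\<^sub>R ?v z \<noteq> 0" using that orbit_velocity_nonzero[OF z] by simp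
      then have "?v z + c *\<^sub>R ?v z \<noteq> 0" by (simp add: scaleR_left_distrib)
      then show ?thesis by (metis eq_neg_iff_add_eq_0 neg_eq_iff_add_eq_0)
    qed
    then have 2: "\<not> (\<exists>c>0. ?v z = - (c *\<^sub>R ?v z))" "\<not> (\<exists>c>0. - ?v z = c *\<^sub>R ?v z)" by blast+
    show "(z, ?v z) \<in> ?T \<longleftrightarrow> w \<in> P" "(z, - ?v z) \<in> ?T \<longleftrightarrow> w \<in> N"
      by (simp_all add: orbit_link_tangent[OF z] 1 2)
  qed
  have all: "(\<forall>z\<in>orbit w. (z, ?v z) \<in> ?T) \<longleftrightarrow> w \<in> P"
    "(\<forall>z\<in>orbit w. (z, - ?v z) \<in> ?T) \<longleftrightarrow> w \<in> N" for w
    using T orbit_nonempty[of w] by auto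
  show "positive_components p q (orbit_link P N) = orbit ` P"
    "negative_components p q (orbit_link P N) = orbit ` N"
    unfolding positive_components_def negative_components_def components_orbit_link[OF assms(1-3)]
    using all by auto
qed

text \<open>The normal form maps onto the complex numbers, so the rank of the differential of
  \<open>f\<close> is that of the planar map \<open>M\<close>. Every zero of \<phi> is seen, since
  its orbit is nonempty and lies off both axes.\<close>

lemma nondegenerate_models_iff:
  assumes "models n m f \<phi>"
  shows "nondegenerate f \<longleftrightarrow> (\<forall>w. \<phi> w = 0 \<longrightarrow> jac (frechet_derivative \<phi> (at w)) \<noteq> 0)"
proof -
  have full: "dim (range (frechet_derivative (mixed_eval f) (at z))) = 2
      \<longleftrightarrow> jac (frechet_derivative \<phi> (at w)) \<noteq> 0"
    if z: "fst z \<noteq> 0" "snd z \<noteq> 0" "w = fst z ^ q / snd z ^ p" "\<phi> w = 0" for z w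
  proof -
    obtain M where M: "linear M" "(mixed_eval f has_derivative (\<lambda>v. M (normal_form z v))) (at z)"
      "sgn (jac M) = sgn (jac (frechet_derivative \<phi> (at w)))"
      using models_normal_map[OF assms z] .
    have D: "frechet_derivative (mixed_eval f) (at z) = (\<lambda>v. M (normal_form z v))"
      using M(2) frechet_derivative_at by metis
    have "range (normal_form z) = UNIV"
      using normal_form_surj[OF z(2)] unfolding surj_def by metis
    then have "range (\<lambda>v. M (normal_form z v)) = range M"
      by (metis image_image)
    moreover have "span (range M) = range M"
      by (rule span_eq_iff[THEN iffD2]) (rule linear_subspace_image[OF M(1) subspace_UNIV])
    then have "dim (range M) = 2 \<longleftrightarrow> surj M" using dim_eq_full[of "range M"] by (metis DIM_complex)
    ultimately have "dim (range (frechet_derivative (mixed_eval f) (at z))) = 2 \<longleftrightarrow> surj M"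
      by (simp only: D)
    also have "\<dots> \<longleftrightarrow> jac M \<noteq> 0"
    proof
      assume "surj M"
      then obtain x y where "M x = 1" "M y = \<i>" by (metis surjD)
      then show "jac M \<noteq> 0" by (rule jac_zero_not_surj[OF M(1)])
    next
      assume "jac M \<noteq> 0"
      then show "surj M" unfolding surj_def using jac_nonzero_surj[OF M(1)] by metis
    qed
    also have "\<dots> \<longleftrightarrow> jac (frechet_derivative \<phi> (at w)) \<noteq> 0"
      using M(3) by (metis sgn_0_0)
    finally show ?thesis .
  qed
  show ?thesis
  proof
    assume nd: "nondegenerate f"
    show "\<forall>w. \<phi> w = 0 \<longrightarrow> jac (frechet_derivative \<phi> (at w)) \<noteq> 0"
    proof (intro allI impI)
      fix w assume w: "\<phi> w = 0"
      then have "w \<noteq> 0" using assms by (auto simp: models_def)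
      obtain z where z: "z \<in> orbit w" using orbit_nonempty[of w] by blast
      have nz: "fst z \<noteq> 0" "snd z \<noteq> 0"
        using orbit_fst_nonzero orbit_snd_nonzero z \<open>w \<noteq> 0\<close> by auto
      have "mixed_eval f z = 0"
        using models_eval[OF assms nz(2)] orbit_ratio[OF z] w by simp
      then have "dim (range (frechet_derivative (mixed_eval f) (at z))) = 2"
        using nd nz unfolding nondegenerate_def by (metis prod.collapse)
      then show "jac (frechet_derivative \<phi> (at w)) \<noteq> 0"
        using full[OF nz orbit_ratio[OF z, symmetric] w] by simp
    qed
  next
    assume *: "\<forall>w. \<phi> w = 0 \<longrightarrow> jac (frechet_derivative \<phi> (at w)) \<noteq> 0"
    show "nondegenerate f"
      unfolding nondegenerate_def
    proof (intro allI impI)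
      fix x y assume xy: "x \<noteq> 0" "y \<noteq> 0" "mixed_eval f (x, y) = 0"
      then have "\<phi> (x ^ q / y ^ p) = 0" using models_eval[OF assms, of "(x, y)"] by simp
      with * show "dim (range (frechet_derivative (mixed_eval f) (at (x, y)))) = 2"
        using full[of "(x, y)", OF _ _ refl] xy by simp
    qed
  qed
qed

lemma not_transverse:
  assumes "models n m f \<phi>" "z \<in> orbit w" "\<phi> w = 0" "jac (frechet_derivative \<phi> (at w)) = 0"
  shows "\<not> transverse_at f z"
proof
  assume tr: "transverse_at f z"
  have "w \<noteq> 0" using assms(1,3) by (auto simp: models_def)
  then have nz: "fst z \<noteq> 0" "snd z \<noteq> 0" using orbit_fst_nonzero orbit_snd_nonzero assms(2) by auto
  obtain M where M: "linear M" "(mixed_eval f has_derivative (\<lambda>v. M (normal_form z v))) (at z)"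
    "sgn (jac M) = sgn (jac (frechet_derivative \<phi> (at w)))"
    using models_normal_map[OF assms(1) nz orbit_ratio[OF assms(2), symmetric] assms(3)] .
  have D: "frechet_derivative (mixed_eval f) (at z) = (\<lambda>v. M (normal_form z v))"
    using M(2) frechet_derivative_at by metis
  obtain x y where "M x = 1" "M y = \<i>"
    using tr unfolding transverse_at_def D by (metis (no_types, lifting) UNIV_I imageE)
  then show False using jac_zero_not_surj[OF M(1)] M(3) assms(4) by (metis sgn_0_0)
qed

text \<open>Compactness comes from the sphere: the zero set is the continuous image of the link,
  which stays away from \<open>z2 = 0\<close>.\<close>

lemma finite_zeros_models:
  assumes "models n m f \<phi>" and "\<And>w. \<phi> w = 0 \<Longrightarrow> jac (frechet_derivative \<phi> (at w)) \<noteq> 0"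
  shows "finite {w. \<phi> w = 0}"
proof (rule finite_zeros)
  show "poly_fun \<phi>" using assms(1) by (simp add: models_def)
  let ?r = "\<lambda>z :: C2. fst z ^ q / snd z ^ p"
  have "link_of f = sphere 0 1 \<inter> {z. mixed_eval f z = 0}" by (auto simp: link_of_def)
  moreover have "closed {z. mixed_eval f z = 0}"
    by (intro closed_Collect_eq poly_fun_continuous poly_fun_mixed_eval poly_fun.const)
  ultimately have "compact (link_of f)" by (simp add: compact_Int_closed)
  moreover have "snd z \<noteq> 0" if "z \<in> link_of f" for z
    using that orbit_snd_nonzero unfolding link_of_models[OF assms(1)] by blast
  then have "continuous_on (link_of f) ?r" by (intro continuous_intros) auto
  ultimately have "compact (?r ` link_of f)" by (intro compact_continuous_image)
  moreover have "?r ` link_of f = {w. \<phi> w = 0}"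
    unfolding link_of_models[OF assms(1)] image_UN
  proof -
    have "?r ` orbit w = {w}" for w using orbit_nonempty[of w] orbit_ratio[of _ w] by auto
    then show "(\<Union>w\<in>{w. \<phi> w = 0}. ?r ` orbit w) = {w. \<phi> w = 0}" by auto
  qed
  ultimately show "compact {w. \<phi> w = 0}" by simp
qed (use assms(2) in auto)

section \<open>Separate holomorphic and antiholomorphic degrees\<close>

definition bihomogeneous :: "nat \<Rightarrow> nat \<Rightarrow> mixed_poly \<Rightarrow> bool" where
  "bihomogeneous n m f \<longleftrightarrow> (\<forall>((n1, n2), (m1, m2)) \<in> Poly_Mapping.keys f.
     p * n1 + q * n2 = p * q * n \<and> p * m1 + q * m2 = p * q * m)"

text \<open>The radial degree is the sum and the polar degree the difference of the two weighted
  degrees \<open>p * q * n\<close> and \<open>p * q * m\<close>.\<close>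

lemma bihomogeneous_imp_polar:
  assumes "bihomogeneous n m f" "n = m + d"
  shows "strongly_polar_weighted_homogeneous p q (p * q * (n + m)) (int (d * p * q)) f"
  unfolding strongly_polar_weighted_homogeneous_def
proof clarify
  fix n1 n2 m1 m2 assume "((n1, n2), m1, m2) \<in> Poly_Mapping.keys f"
  then have e: "p * n1 + q * n2 = p * q * n" "p * m1 + q * m2 = p * q * m"
    using assms(1) by (auto simp: bihomogeneous_def)
  then have "int p * int n1 + int q * int n2 = int p * int q * int n"
    "int p * int m1 + int q * int m2 = int p * int q * int m"
    by (metis of_nat_add of_nat_mult)+
  then show "p * (n1 + m1) + q * (n2 + m2) = p * q * (n + m) \<and>
     int p * (int n1 - int m1) + int q * (int n2 - int m2) = int (d * p * q)"
    using e assms(2) by (auto simp: algebra_simps)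
qed

text \<open>Half the sum and half the difference of the two degree conditions fix the holomorphic
  and the antiholomorphic degree separately. Comparing the pure monomials in \<open>z1\<close> and
  in \<open>z2\<close> makes both degrees multiples of \<open>p\<close> and of \<open>q\<close>,
  hence of \<open>p * q\<close>.\<close>

lemma bihomogeneousI:
  assumes "convenient f" "strongly_polar_weighted_homogeneous p q dr dp f"
  obtains n m where "bihomogeneous n m f"
proof -
  let ?K = "Poly_Mapping.keys f"
  obtain a b a' b' where ab: "((a, 0), (b, 0)) \<in> ?K" "((0, a'), (0, b')) \<in> ?K"
    using assms(1) by (auto simp: convenient_def in_keys_iff)
  have h: "p * (n1 + m1) + q * (n2 + m2) = dr \<and>
      int p * (int n1 - int m1) + int q * (int n2 - int m2) = dp"
    if "((n1, n2), (m1, m2)) \<in> ?K" for n1 n2 m1 m2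
    using assms(2) that by (fastforce simp: strongly_polar_weighted_homogeneous_def)
  have k: "p * n1 + q * n2 = p * a \<and> p * m1 + q * m2 = p * b"
    if "((n1, n2), (m1, m2)) \<in> ?K" for n1 n2 m1 m2
  proof -
    have "int (p * (n1 + m1) + q * (n2 + m2)) = int (p * (a + b) + q * (0 + 0))"
      using h[OF that] h[OF ab(1)] by simp
    moreover have "int p * (int n1 - int m1) + int q * (int n2 - int m2) =
        int p * (int a - int b) + int q * (int 0 - int 0)"
      using h[OF that] h[OF ab(1)] by simp
    ultimately have "int (p * n1 + q * n2) = int (p * a)" "int (p * m1 + q * m2) = int (p * b)"
      by (simp_all add: algebra_simps)
    then show ?thesis by (simp only: of_nat_eq_iff)
  qed
  have "q * a' = p * a" "q * b' = p * b" using k[OF ab(2)] by auto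
  then have "q dvd p * a" "q dvd p * b" by (metis dvd_triv_left)+
  then have "q dvd a" "q dvd b"
    using coprime_pq by (simp_all add: coprime_dvd_mult_right_iff coprime_commute)
  then obtain n m where "a = q * n" "b = q * m" by (auto elim!: dvdE)
  then have "bihomogeneous n m f" using k by (force simp: bihomogeneous_def mult.assoc)
  then show ?thesis by (rule that)
qed

lemma weighted_degree_split:
  assumes "p * i + q * j = p * q * n"
  obtains i' j' where "i = q * i'" "j = p * j'" "n = i' + j'"
proof -
  have "q dvd p * i" "p dvd q * j"
    using assms by (metis dvd_add_left_iff dvd_triv_left dvd_triv_right mult.assoc mult.commute
        mult.left_commute, metis dvd_add_right_iff dvd_triv_left mult.assoc)
  then have "q dvd i" "p dvd j"
    using coprime_pq by (simp_all add: coprime_dvd_mult_right_iff coprime_commute)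
  then obtain i' j' where ij: "i = q * i'" "j = p * j'" by (auto elim!: dvdE)
  then have "(p * q) * (i' + j') = (p * q) * n" using assms by (simp add: algebra_simps)
  then have "n = i' + j'" using p_pos q_pos by simp
  then show ?thesis using ij that by blast
qed

text \<open>Dehomogenisation in \<open>z2\<close>. Convenience gives nonvanishing at
  \<open>w = 0\<close> and at infinity, because on each axis exactly one monomial survives.\<close>

lemma models_exists:
  assumes "convenient f" "bihomogeneous n m f"
  shows "\<exists>\<phi>. models n m f \<phi>"
proof -
  let ?K = "Poly_Mapping.keys f"
  \<comment> \<open>By \<open>split\<close> below, the divisions are exact; the exponents of
    \<open>z2\<close> are then determined by \<open>n\<close> and \<open>m\<close>.\<close>
  define \<phi> where "\<phi> w = (\<Sum>k\<in>?K. Poly_Mapping.lookup f k *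
     (w ^ (fst (fst k) div q) * cnj w ^ (fst (snd k) div q)))" for w
  have split: "\<exists>i j i' j'. k = ((q * i, p * j), (q * i', p * j')) \<and> n = i + j \<and> m = i' + j'"
    if "k \<in> ?K" for k
  proof -
    obtain n1 n2 m1 m2 where k: "k = ((n1, n2), (m1, m2))" by (metis surj_pair)
    then have e: "p * n1 + q * n2 = p * q * n" "p * m1 + q * m2 = p * q * m"
      using assms(2) that by (auto simp: bihomogeneous_def)
    obtain i j where "n1 = q * i" "n2 = p * j" "n = i + j"
      using weighted_degree_split[OF e(1)] by blast
    moreover obtain i' j' where "m1 = q * i'" "m2 = p * j'" "m = i' + j'"
      using weighted_degree_split[OF e(2)] by blast
    ultimately show ?thesis using k by blast
  qed
  have eval: "mixed_eval f z = (snd z ^ p) ^ n * cnj (snd z ^ p) ^ m * \<phi> (fst z ^ q / snd z ^ p)"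
    if z: "snd z \<noteq> 0" for z
    unfolding mixed_eval_keys \<phi>_def sum_distrib_left
  proof (rule sum.cong[OF refl])
    fix k assume "k \<in> ?K"
    then obtain i j i' j' where k: "k = ((q * i, p * j), (q * i', p * j'))" "n = i + j" "m = i' + j'"
      using split by blast
    obtain x y where [simp]: "z = (x, y)" by (cases z)
    have [simp]: "y \<noteq> 0" using z by simp
    show "Poly_Mapping.lookup f k * mixed_monom k z =
      (snd z ^ p) ^ n * cnj (snd z ^ p) ^ m * (Poly_Mapping.lookup f k *
       ((fst z ^ q / snd z ^ p) ^ (fst (fst k) div q) * cnj (fst z ^ q / snd z ^ p) ^ (fst (snd k) div q)))"
      using q_pos
      by (simp add: k mixed_monom_def power_mult power_commutes[symmetric] power_add power_divide)
  qed
  have single: "mixed_eval f z = Poly_Mapping.lookup f k * mixed_monom k z"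
    if "k \<in> ?K" "\<And>l. l \<in> ?K \<Longrightarrow> l \<noteq> k \<Longrightarrow> mixed_monom l z = 0" for k z
    unfolding mixed_eval_keys using that by (subst sum.remove[of _ k]) (auto intro!: sum.neutral)
  obtain a b where ab: "((a, 0), (b, 0)) \<in> ?K"
    using assms(1) by (auto simp: convenient_def in_keys_iff)
  obtain a' b' where ab': "((0, a'), (0, b')) \<in> ?K"
    using assms(1) by (auto simp: convenient_def in_keys_iff)
  have "mixed_eval f (x, 0) \<noteq> 0" if "x \<noteq> 0" for x
  proof -
    \<comment> \<open>A monomial free of \<open>z2\<close> has the exponents \<open>q * n\<close>
      and \<open>q * m\<close>, so it is the one given by convenience.\<close>
    have "mixed_monom l (x, 0) = 0" if l: "l \<in> ?K" "l \<noteq> ((a, 0), (b, 0))" for l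
    proof -
      obtain i j i' j' where "l = ((q * i, p * j), (q * i', p * j'))" "n = i + j" "m = i' + j'"
        using split[OF l(1)] by blast
      moreover have "a = q * n" "b = q * m" using split[OF ab] p_pos by auto
      ultimately show ?thesis using l(2) p_pos by (auto simp: mixed_monom_def zero_power)
    qed
    then have "mixed_eval f (x, 0) = Poly_Mapping.lookup f ((a, 0), (b, 0)) * (x ^ a * cnj x ^ b)"
      using single[OF ab] by (simp add: mixed_monom_def)
    then show ?thesis using ab that by (simp add: in_keys_iff)
  qed
  moreover have "\<phi> 0 \<noteq> 0"
  proof -
    have "mixed_monom l (0, 1) = 0" if l: "l \<in> ?K" "l \<noteq> ((0, a'), (0, b'))" for l
    proof -
      obtain i j i' j' where "l = ((q * i, p * j), (q * i', p * j'))" "n = i + j" "m = i' + j'"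
        using split[OF l(1)] by blast
      moreover have "a' = p * n" "b' = p * m" using split[OF ab'] q_pos by auto
      ultimately show ?thesis using l(2) q_pos by (auto simp: mixed_monom_def zero_power)
    qed
    then have "mixed_eval f (0, 1) = Poly_Mapping.lookup f ((0, a'), (0, b'))"
      using single[OF ab'] by (simp add: mixed_monom_def)
    moreover have "mixed_eval f (0, 1) = \<phi> 0" using eval[of "(0, 1)"] q_pos by (simp add: zero_power)
    ultimately show ?thesis using ab' by (simp add: in_keys_iff)
  qed
  moreover have "poly_fun \<phi>"
    unfolding \<phi>_def by (intro poly_fun_sum poly_fun.mult poly_fun.const poly_fun_power poly_fun_cnj
        poly_fun.lin bounded_linear_ident)
  ultimately show ?thesis unfolding models_def using eval by blast
qed

text \<open>At a coordinate point all monomials involving the other variable vanish, so a nonzero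
  value must come from a pure one.\<close>

lemma convenientI:
  assumes "mixed_eval f (1, 0) \<noteq> 0" "mixed_eval f (0, 1) \<noteq> 0"
  shows "convenient f"
proof -
  obtain k where k: "k \<in> Poly_Mapping.keys f" "mixed_monom k (1, 0) \<noteq> 0"
    using assms(1) unfolding mixed_eval_keys by (metis (no_types, lifting) mult_zero_right sum.neutral)
  obtain l where l: "l \<in> Poly_Mapping.keys f" "mixed_monom l (0, 1) \<noteq> 0"
    using assms(2) unfolding mixed_eval_keys by (metis (no_types, lifting) mult_zero_right sum.neutral)
  have "\<exists>a b. k = ((a, 0), (b, 0))" "\<exists>a b. l = ((0, a), (0, b))"
    using k(2) l(2) by (auto simp: mixed_monom_def power_0_left split: prod.splits if_splits)
  then show ?thesis using k(1) l(1) by (auto simp: convenient_def in_keys_iff)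
qed

section \<open>Between links and signed zero sets\<close>

lemma link_space_negE:
  assumes "L \<in> link_space_neg p q d r" "r > 0"
  obtains P N where "finite P" "finite N" "0 \<notin> P \<union> N" "P \<inter> N = {}"
    "card P = d + r" "card N = r" "L = orbit_link P N"
proof -
  obtain f dr where f: "L = oriented_link_of f" "convenient f" "nondegenerate f"
      "strongly_polar_weighted_homogeneous p q dr (int (d * p * q)) f"
    and card: "card (components (fst L)) = d + 2 * r" "card (negative_components p q L) = r"
    using assms(1) by (auto simp: link_space_neg_def link_space_def)
  obtain n m \<phi> where m: "models n m f \<phi>"
    using bihomogeneousI[OF f(2,4)] models_exists[OF f(2)] by metis
  have jac: "\<And>w. \<phi> w = 0 \<Longrightarrow> jac (frechet_derivative \<phi> (at w)) \<noteq> 0"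
    using nondegenerate_models_iff[OF m] f(3) by blast
  define P where "P = {w. \<phi> w = 0 \<and> jac (frechet_derivative \<phi> (at w)) > 0}"
  define N where "N = {w. \<phi> w = 0 \<and> jac (frechet_derivative \<phi> (at w)) < 0}"
  have L: "L = orbit_link P N"
    unfolding P_def N_def f(1) by (rule oriented_link_of_models[OF m jac])
  have fin: "finite P" "finite N"
    using finite_zeros_models[OF m jac] by (auto simp: P_def N_def elim: rev_finite_subset)
  have 0: "0 \<notin> P \<union> N" using m by (auto simp: P_def N_def models_def)
  have disj: "P \<inter> N = {}" by (auto simp: P_def N_def)
  have N: "card N = r"
    using card(2) unfolding L signed_components_orbit_link(2)[OF fin 0 disj]
    by (simp add: card_image inj_orbit)
  have "card (P \<union> N) = d + 2 * r"
    using card(1) unfolding L components_orbit_link[OF fin 0] by (simp add: card_image inj_orbit)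
  then have "card P = d + r" using N card_Un_disjoint[OF fin disj] by simp
  then show ?thesis using that fin 0 disj N L by blast
qed

text \<open>The criterion by which the constructed polynomials are recognised;
  \<open>n = m + d\<close> encodes the polar degree \<open>d * p * q\<close>.\<close>

lemma link_space_negI:
  assumes "bihomogeneous n m f" "n = m + d" "models n m f \<phi>"
    and "finite P" "finite N" "{w. \<phi> w = 0} = P \<union> N"
    and P: "\<And>w. w \<in> P \<Longrightarrow> jac (frechet_derivative \<phi> (at w)) > 0"
    and N: "\<And>w. w \<in> N \<Longrightarrow> jac (frechet_derivative \<phi> (at w)) < 0"
    and "card P = d + r" "card N = r"
  shows "oriented_link_of f = orbit_link P N" "orbit_link P N \<in> link_space_neg p q d r"
proof -
  have disj: "P \<inter> N = {}" using P N by fastforce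
  have jac: "\<And>w. \<phi> w = 0 \<Longrightarrow> jac (frechet_derivative \<phi> (at w)) \<noteq> 0"
    using P N assms(6) by fastforce
  have 0: "0 \<notin> P \<union> N" using assms(3,6) by (auto simp: models_def)
  have "{w. \<phi> w = 0 \<and> jac (frechet_derivative \<phi> (at w)) > 0} = P"
    "{w. \<phi> w = 0 \<and> jac (frechet_derivative \<phi> (at w)) < 0} = N"
    using assms(6) P N by (auto dest: less_asym) (fastforce+)?
  then show L: "oriented_link_of f = orbit_link P N"
    using oriented_link_of_models[OF assms(3) jac] by simp
  have "mixed_eval f (0, 1) = \<phi> 0"
    using models_eval[OF assms(3), of "(0, 1)"] q_pos by (simp add: zero_power)
  then have "convenient f" using assms(3) by (intro convenientI) (auto simp: models_def)
  moreover have "nondegenerate f" using nondegenerate_models_iff[OF assms(3)] jac by blast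
  ultimately have "orbit_link P N \<in> link_space p q (int (d * p * q))"
    unfolding link_space_def L[symmetric] using bihomogeneous_imp_polar[OF assms(1,2)] by blast
  moreover have "card (components (fst (orbit_link P N))) = d + 2 * r"
    using components_orbit_link[OF assms(4,5) 0] card_Un_disjoint[OF assms(4,5) disj] assms(9,10)
    by (simp add: card_image inj_orbit)
  moreover have "card (negative_components p q (orbit_link P N)) = r"
    using signed_components_orbit_link(2)[OF assms(4,5) 0 disj] assms(10)
    by (simp add: card_image inj_orbit)
  ultimately show "orbit_link P N \<in> link_space_neg p q d r" by (simp add: link_space_neg_def)
qed

end

subsection \<open>The eliminating factor\<close>

lemma frechet_derivative_mult_zero:
  fixes g h :: "complex \<Rightarrow> complex"
  assumes "poly_fun g" "(h has_derivative h') (at w)" "h w = 0"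
  shows "frechet_derivative (\<lambda>w. g w * h w) (at w) = (\<lambda>\<eta>. g w * h' \<eta>)"
proof -
  have "((\<lambda>w. g w * h w) has_derivative
      (\<lambda>\<eta>. g w * h' \<eta> + frechet_derivative g (at w) \<eta> * h w)) (at w)"
    by (rule has_derivative_mult[OF poly_fun_frechet(1)[OF assms(1)] assms(2)])
  then have "((\<lambda>w. g w * h w) has_derivative (\<lambda>\<eta>. g w * h' \<eta>)) (at w)"
    by (simp add: assms(3))
  then show ?thesis by (rule frechet_derivative_at[symmetric])
qed

text \<open>The point \<open>w\<close> at infinity has the coordinate
  \<open>\<zeta> = \<kappa>\<close>, so \<open>not_one\<close> keeps infinity off the positive ray
  along which the zeros travel.\<close>

locale eliminating_factor =
  fixes a b \<kappa> :: complex
  assumes distinct: "a \<noteq> b" and unit: "cmod \<kappa> = 1" and not_one: "\<kappa> \<noteq> 1"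
begin

text \<open>In the coordinate \<open>\<zeta> = \<kappa> (w - a) / (w - b)\<close> this is \<open>|w - b|\<^sup>2\<close> times
  \<open>t (|\<zeta>|\<^sup>2 + 1) - \<zeta>\<close>, whose zeros are the real positive roots of \<open>t (s\<^sup>2 + 1) = s\<close>. The zeros
  travel from \<open>a\<close> and \<open>b\<close> along the circular arc where \<open>\<zeta>\<close> is positive, merge at
  \<open>t = 1/2\<close>, and disappear.\<close>

definition \<psi> :: "real \<Rightarrow> complex \<Rightarrow> complex" where
  "\<psi> t w = of_real t * ((w - a) * cnj (w - a) + (w - b) * cnj (w - b)) - \<kappa> * (w - a) * cnj (w - b)"

text \<open>The point with \<open>\<zeta> = x / y\<close>.\<close>

definition arc_point :: "real \<Rightarrow> real \<Rightarrow> complex" where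
  "arc_point x y = (\<kappa> * a * of_real y - b * of_real x) / (\<kappa> * of_real y - of_real x)"

text \<open>Comparing moduli would give \<open>x = y\<close>, and then
  \<open>\<kappa> = 1\<close>.\<close>

lemma denominator_nonzero:
  assumes "x \<ge> 0" "y \<ge> 0" "x \<noteq> 0 \<or> y \<noteq> 0"
  shows "\<kappa> * of_real y - of_real x \<noteq> 0"
proof
  assume "\<kappa> * of_real y - of_real x = 0"
  then have *: "\<kappa> * of_real y = of_real x" by simp
  then have "cmod (\<kappa> * of_real y) = cmod (of_real x)" by simp
  then have "y = x" using assms unit by (simp add: norm_mult)
  then show False using * assms(3) not_one by simp
qed

text \<open>The pair \<open>x\<close>, \<open>y\<close> is a homogeneous coordinate, so the end
  points \<open>a\<close> (\<open>x = 0\<close>) and \<open>b\<close> (\<open>y = 0\<close>) need no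
  special treatment.\<close>

lemma arc_point_iff:
  assumes "x \<ge> 0" "y \<ge> 0" "x \<noteq> 0 \<or> y \<noteq> 0"
  shows "\<kappa> * (w - a) * of_real y = (w - b) * of_real x \<longleftrightarrow> w = arc_point x y"
proof -
  have "\<kappa> * (w - a) * of_real y = (w - b) * of_real x \<longleftrightarrow>
      w * (\<kappa> * of_real y - of_real x) = \<kappa> * a * of_real y - b * of_real x"
    by (auto simp: algebra_simps)
  then show ?thesis
    using denominator_nonzero[OF assms] by (simp add: arc_point_def nonzero_eq_divide_eq)
qed

text \<open>The common scale \<mu> treats both ends of the arc alike; it contributes only its
  squared modulus to \<psi> and to the Jacobian.\<close>

lemma arc_point_scale:
  assumes "x \<ge> 0" "y \<ge> 0" "x \<noteq> 0 \<or> y \<noteq> 0" "w = arc_point x y"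
  obtains \<mu> where "\<mu> \<noteq> 0" "w - a = cnj \<kappa> * \<mu> * of_real x" "w - b = \<mu> * of_real y"
proof -
  have e: "\<kappa> * (w - a) * of_real y = (w - b) * of_real x"
    using arc_point_iff[OF assms(1-3)] assms(4) by blast
  have kk: "cnj \<kappa> * \<kappa> = 1" using unit complex_norm_square[of \<kappa>] by (simp add: mult.commute)
  have "\<exists>\<mu>. \<kappa> * (w - a) = \<mu> * of_real x \<and> w - b = \<mu> * of_real y"
  proof (cases "y = 0")
    case True
    then show ?thesis using assms(3) e by (intro exI[of _ "\<kappa> * (w - a) / of_real x"]) auto
  next
    case False
    then show ?thesis using e by (intro exI[of _ "(w - b) / of_real y"]) (auto simp: field_simps)
  qed
  then obtain \<mu> where \<mu>: "\<kappa> * (w - a) = \<mu> * of_real x" "w - b = \<mu> * of_real y" by blast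
  have "w - a = (cnj \<kappa> * \<kappa>) * (w - a)" by (simp add: kk)
  also have "\<dots> = cnj \<kappa> * \<mu> * of_real x" using \<mu>(1) by (simp add: mult.assoc)
  finally have 1: "w - a = cnj \<kappa> * \<mu> * of_real x" .
  have "\<mu> \<noteq> 0" using 1 \<mu>(2) distinct by auto
  then show ?thesis using 1 \<mu>(2) that by blast
qed

text \<open>The roots of \<open>t * (u\<^sup>2 + 1) = u\<close> have product 1. In homogeneous form
  they are \<open>1 + s : 2 * t\<close> and its inverse, which remain meaningful at
  \<open>t = 0\<close>.\<close>

lemma \<psi>_zero_iff:
  assumes "0 \<le> t" "t \<le> 1 / 2"
  defines "s \<equiv> sqrt (1 - 4 * t\<^sup>2)"
  shows "\<psi> t w = 0 \<longleftrightarrow> w = arc_point (2 * t) (1 + s) \<or> w = arc_point (1 + s) (2 * t)"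
proof -
  have "(2 * t)\<^sup>2 \<le> 1\<^sup>2" using assms(1,2) by (intro power_mono) auto
  then have "1 - 4 * t\<^sup>2 \<ge> 0" by (simp add: power_mult_distrib)
  then have s: "s \<ge> 0" "s\<^sup>2 = 1 - 4 * t\<^sup>2" unfolding s_def by auto
  have nn: "2 * t \<ge> 0" "1 + s \<ge> 0" "2 * t \<noteq> 0 \<or> 1 + s \<noteq> 0" "1 + s \<noteq> 0 \<or> 2 * t \<noteq> 0"
    using assms(1) s(1) by auto
  have kk: "\<kappa> * cnj \<kappa> = 1" using unit complex_norm_square[of \<kappa>] by simp
  have zero_at: "\<psi> t w = 0"
    if w: "w = arc_point x y" and xy: "x \<ge> 0" "y \<ge> 0" "x \<noteq> 0 \<or> y \<noteq> 0" "t * (x\<^sup>2 + y\<^sup>2) = x * y" for x y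
  proof -
    obtain \<mu> where m: "w - a = cnj \<kappa> * \<mu> * of_real x" "w - b = \<mu> * of_real y"
      using arc_point_scale[OF xy(1-3) w] by blast
    have "\<psi> t w = \<mu> * cnj \<mu> * (of_real t * ((\<kappa> * cnj \<kappa>) * of_real x ^ 2 + of_real y ^ 2)
        - (\<kappa> * cnj \<kappa>) * of_real x * of_real y)"
      unfolding \<psi>_def m by (simp add: algebra_simps power2_eq_square)
    also have "\<dots> = \<mu> * cnj \<mu> * of_real (t * (x\<^sup>2 + y\<^sup>2) - x * y)"
      unfolding kk by simp
    finally show ?thesis using xy(4) by simp
  qed
  \<comment> \<open>The quadratic is symmetric in its two homogeneous coordinates, so this one
    identity covers both roots.\<close>
  have q: "t * ((2 * t)\<^sup>2 + (1 + s)\<^sup>2) = (2 * t) * (1 + s)"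
  proof -
    have "(2 * t)\<^sup>2 + (1 + s)\<^sup>2 = 4 * t\<^sup>2 + 1 + 2 * s + s\<^sup>2" by (simp add: power2_eq_square algebra_simps)
    then show ?thesis unfolding s(2) by (simp add: algebra_simps)
  qed
  show ?thesis
  proof
    assume "w = arc_point (2 * t) (1 + s) \<or> w = arc_point (1 + s) (2 * t)"
    then show "\<psi> t w = 0" using zero_at[OF _ nn(1,2,3) q] zero_at[OF _ nn(2,1,4)] q
      by (auto simp: algebra_simps)
  next
    assume z: "\<psi> t w = 0"
    show "w = arc_point (2 * t) (1 + s) \<or> w = arc_point (1 + s) (2 * t)"
    proof (cases "w = b")
      case True
      then have "t = 0" using z distinct by (auto simp: \<psi>_def)
      then show ?thesis using True arc_point_iff[OF nn(2,1,4), of w] by simp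
    next
      case False
      \<comment> \<open>This is the coordinate \<zeta> of \<open>w\<close>, which the equation
        forces to be real and expresses through the moduli.\<close>
      define u where "u = t * ((cmod (w - a))\<^sup>2 + (cmod (w - b))\<^sup>2) / (cmod (w - b))\<^sup>2"
      have nb: "(cmod (w - b))\<^sup>2 \<noteq> 0" "(w - b) * cnj (w - b) \<noteq> 0" using False by auto
      have "\<kappa> * (w - a) * cnj (w - b) = of_real t * ((w - a) * cnj (w - a) + (w - b) * cnj (w - b))"
        using z by (simp add: \<psi>_def)
      also have "\<dots> = of_real (t * ((cmod (w - a))\<^sup>2 + (cmod (w - b))\<^sup>2))"
        unfolding complex_norm_square[symmetric] by simp
      also have "\<dots> = of_real (u * (cmod (w - b))\<^sup>2)" using nb by (simp add: u_def)
      also have "\<dots> = of_real u * ((w - b) * cnj (w - b))"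
        unfolding complex_norm_square[symmetric] by simp
      finally have k: "\<kappa> * (w - a) = of_real u * (w - b)"
        using nb(2) by (simp del: complex_cnj_diff)
      then have "cmod (\<kappa> * (w - a)) = \<bar>u\<bar> * cmod (w - b)" by (simp add: norm_mult)
      then have "cmod (w - a) = \<bar>u\<bar> * cmod (w - b)" using unit by (simp add: norm_mult)
      then have "(cmod (w - a))\<^sup>2 = u\<^sup>2 * (cmod (w - b))\<^sup>2" by (simp add: power_mult_distrib)
      then have u: "u = t * (u\<^sup>2 + 1)"
        unfolding u_def using nb(1) by (simp add: field_simps)
      \<comment> \<open>Completes the square in \<open>t * u\<^sup>2 - u + t = 0\<close>.\<close>
      have "(2 * t * u - 1)\<^sup>2 = 1 - 4 * t * (u - t * u\<^sup>2)"
        by (simp add: power2_eq_square algebra_simps)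
      also have "u - t * u\<^sup>2 = t" using u by (simp add: algebra_simps)
      finally have "(2 * t * u - 1)\<^sup>2 = s\<^sup>2" unfolding s(2) by (simp add: power2_eq_square)
      then have "2 * t * u = 1 + s \<or> 2 * t * u = 1 - s" by (auto simp: power2_eq_iff)
      \<comment> \<open>The smaller root is rewritten as the inverse of the larger one, so that no
        division by \<open>t\<close> remains.\<close>
      then have "u * (2 * t) = 1 + s \<or> u * (1 + s) = 2 * t"
      proof
        assume *: "2 * t * u = 1 - s"
        show ?thesis
        proof (cases "t = 0")
          case True
          then show ?thesis using u by simp
        next
          case False
          have "(2 * t) * (u * (1 + s)) = (2 * t * u) * (1 + s)" by simp
          also have "\<dots> = (1 - s) * (1 + s)" unfolding * ..
          also have "\<dots> = 1 - s\<^sup>2" by (simp add: algebra_simps power2_eq_square)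
          also have "\<dots> = (2 * t) * (2 * t)" unfolding s(2) by (simp add: power2_eq_square)
          finally show ?thesis using False by simp
        qed
      qed (simp add: mult_ac)
      then have "\<kappa> * (w - a) * of_real (2 * t) = (w - b) * of_real (1 + s) \<or>
          \<kappa> * (w - a) * of_real (1 + s) = (w - b) * of_real (2 * t)"
        unfolding k by (metis mult.assoc mult.commute of_real_mult)
      then show ?thesis using arc_point_iff[OF nn(1,2,3)] arc_point_iff[OF nn(2,1,4)] by blast
    qed
  qed
qed

text \<open>Arithmetic-geometric mean inequality for the distances from \<open>w\<close> to
  \<open>a\<close> and \<open>b\<close>; its constant is the threshold \<open>1 / 2\<close>.\<close>

lemma \<psi>_nonzero:
  assumes "t > 1 / 2"
  shows "\<psi> t w \<noteq> 0"
proof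
  assume z: "\<psi> t w = 0"
  let ?x = "cmod (w - a)" and ?y = "cmod (w - b)"
  have "of_real t * ((w - a) * cnj (w - a) + (w - b) * cnj (w - b)) = complex_of_real (t * (?x\<^sup>2 + ?y\<^sup>2))"
    unfolding complex_norm_square[symmetric] by simp
  moreover have "of_real t * ((w - a) * cnj (w - a) + (w - b) * cnj (w - b)) = \<kappa> * (w - a) * cnj (w - b)"
    using z by (simp add: \<psi>_def)
  ultimately have "cmod (complex_of_real (t * (?x\<^sup>2 + ?y\<^sup>2))) = cmod (\<kappa> * (w - a) * cnj (w - b))"
    by metis
  also have "\<dots> = ?x * ?y" by (simp add: norm_mult unit del: complex_cnj_diff)
  also have "cmod (complex_of_real (t * (?x\<^sup>2 + ?y\<^sup>2))) = t * (?x\<^sup>2 + ?y\<^sup>2)"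
    using assms by (simp only: norm_of_real abs_of_nonneg) auto
  finally have e: "t * (?x\<^sup>2 + ?y\<^sup>2) = ?x * ?y" .
  have "?x\<^sup>2 + ?y\<^sup>2 > 0" using distinct by (auto simp: sum_power2_gt_zero_iff)
  then have "(1 / 2) * (?x\<^sup>2 + ?y\<^sup>2) < t * (?x\<^sup>2 + ?y\<^sup>2)" using assms by (intro mult_strict_right_mono)
  moreover have "?x * ?y \<le> (1 / 2) * (?x\<^sup>2 + ?y\<^sup>2)"
    using sum_squares_bound[of ?x ?y] by simp
  ultimately show False using e by simp
qed

lemma \<psi>_has_derivative:
  "(\<psi> t has_derivative (\<lambda>\<eta>.
      (of_real t * (cnj (w - a) + cnj (w - b)) - \<kappa> * cnj (w - b)) * \<eta> +
      (of_real t * ((w - a) + (w - b)) - \<kappa> * (w - a)) * cnj \<eta>)) (at w)"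
  unfolding \<psi>_def
  by (auto intro!: derivative_eq_intros has_derivative_cnj simp: algebra_simps)

lemma poly_fun_\<psi>: "poly_fun (\<psi> t)"
  unfolding \<psi>_def
  by (intro poly_fun_diff poly_fun.add poly_fun.mult poly_fun_cnj poly_fun.const
      poly_fun.lin[OF bounded_linear_ident])

text \<open>The difference \<open>y\<^sup>2 - x\<^sup>2\<close> carries the sign: it is opposite for
  the two zeros, which have \<open>x\<close> and \<open>y\<close> interchanged, and it vanishes
  where they meet.\<close>

lemma jac_\<psi>:
  assumes "w - a = cnj \<kappa> * \<mu> * of_real x" "w - b = \<mu> * of_real y"
  shows "jac (\<lambda>\<eta>. (of_real t * (cnj (w - a) + cnj (w - b)) - \<kappa> * cnj (w - b)) * \<eta> +
      (of_real t * ((w - a) + (w - b)) - \<kappa> * (w - a)) * cnj \<eta>)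
    = (cmod \<mu>)\<^sup>2 * ((y\<^sup>2 - x\<^sup>2) * (1 - 2 * t * Re \<kappa>))"
proof -
  have kk: "\<kappa> * cnj \<kappa> = 1" using unit complex_norm_square[of \<kappa>] by simp
  have 1: "of_real t * (cnj (w - a) + cnj (w - b)) - \<kappa> * cnj (w - b) =
     cnj \<mu> * (of_real t * (\<kappa> * of_real x + of_real y) - \<kappa> * of_real y)"
    unfolding assms by (simp add: algebra_simps)
  have "of_real t * ((w - a) + (w - b)) - \<kappa> * (w - a) =
     \<mu> * (of_real t * (cnj \<kappa> * of_real x + of_real y) - (\<kappa> * cnj \<kappa>) * of_real x)"
    unfolding assms by (simp add: algebra_simps)
  then have 2: "of_real t * ((w - a) + (w - b)) - \<kappa> * (w - a) =
     \<mu> * (of_real t * (cnj \<kappa> * of_real x + of_real y) - of_real x)"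
    unfolding kk by simp
  have im: "(Im \<kappa>)\<^sup>2 = 1 - (Re \<kappa>)\<^sup>2" using unit cmod_power2[of \<kappa>] by simp
  have "(cmod (of_real t * (\<kappa> * of_real x + of_real y) - \<kappa> * of_real y))\<^sup>2 =
      (Re \<kappa> * (t * x - y) + t * y)\<^sup>2 + (Im \<kappa>)\<^sup>2 * (t * x - y)\<^sup>2"
    unfolding cmod_power2 by (simp add: power2_eq_square algebra_simps)
  moreover have "(cmod (of_real t * (cnj \<kappa> * of_real x + of_real y) - of_real x))\<^sup>2 =
      (Re \<kappa> * (t * x) + (t * y - x))\<^sup>2 + (Im \<kappa>)\<^sup>2 * (t * x)\<^sup>2"
    unfolding cmod_power2 by (simp add: power2_eq_square algebra_simps)
  ultimately have "(cmod (of_real t * (\<kappa> * of_real x + of_real y) - \<kappa> * of_real y))\<^sup>2 -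
     (cmod (of_real t * (cnj \<kappa> * of_real x + of_real y) - of_real x))\<^sup>2 =
     (y\<^sup>2 - x\<^sup>2) * (1 - 2 * t * Re \<kappa>)"
    unfolding im by (simp add: power2_eq_square algebra_simps)
  then show ?thesis
    unfolding jac_wirtinger unfolding 1 2 norm_mult power_mult_distrib
    by (simp add: right_diff_distrib[symmetric])
qed

end

lemma unit_complex_avoiding:
  assumes "finite (E :: complex set)"
  obtains \<kappa> where "cmod \<kappa> = 1" "\<kappa> \<notin> E"
proof -
  \<comment> \<open>A connected set with two distinct points is infinite.\<close>
  have "connected (sphere (0::complex) 1)" by (rule connected_sphere) simp
  moreover have "(1::complex) \<in> sphere 0 1" "(-1::complex) \<in> sphere 0 1" by auto
  then have "sphere (0::complex) 1 \<noteq> {}" "\<not> (\<exists>x. sphere (0::complex) 1 = {x})"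
    by (metis empty_iff, metis one_neq_neg_one singletonD)
  ultimately have "infinite (sphere (0::complex) 1)"
    using connected_finite_iff_sing[of "sphere (0::complex) 1"] by blast
  then have "\<not> sphere 0 1 \<subseteq> E" using finite_subset[OF _ assms] by blast
  then obtain \<kappa> where "\<kappa> \<in> sphere 0 1" "\<kappa> \<notin> E" by blast
  then show ?thesis using that by simp
qed

subsection \<open>The elimination family\<close>

context orbit_action
begin

text \<open>The homogenisation of \<open>w - a\<close>; \<open>clin\<close> below is that of its
  conjugate.\<close>

definition lin :: "complex \<Rightarrow> mixed_poly" where
  "lin a = Poly_Mapping.single ((q, 0), (0, 0)) 1 - Poly_Mapping.single ((0, p), (0, 0)) a"

definition clin :: "complex \<Rightarrow> mixed_poly" where
  "clin a = Poly_Mapping.single ((0, 0), (q, 0)) 1 - Poly_Mapping.single ((0, 0), (0, p)) (cnj a)"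

lemma mixed_eval_lin: "mixed_eval (lin a) z = fst z ^ q - a * snd z ^ p"
  by (cases z) (simp add: lin_def mixed_eval_diff mixed_monom_def)

lemma mixed_eval_clin: "mixed_eval (clin a) z = cnj (fst z ^ q - a * snd z ^ p)"
  by (cases z) (simp add: clin_def mixed_eval_diff mixed_monom_def)

lemma bihomogeneous_diff:
  "bihomogeneous n m f \<Longrightarrow> bihomogeneous n m g \<Longrightarrow> bihomogeneous n m (f - g)"
  unfolding bihomogeneous_def using keys_diff[of f g] by blast

lemma bihomogeneous_add:
  "bihomogeneous n m f \<Longrightarrow> bihomogeneous n m g \<Longrightarrow> bihomogeneous n m (f + g)"
  unfolding bihomogeneous_def using keys_add[of f g] by blast

lemma bihomogeneous_mult:
  assumes "bihomogeneous n m f" "bihomogeneous n' m' g"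
  shows "bihomogeneous (n + n') (m + m') (f * g)"
  unfolding bihomogeneous_def
proof clarify
  fix n1 n2 m1 m2 assume "((n1, n2), m1, m2) \<in> Poly_Mapping.keys (f * g)"
  then obtain k l where kl: "k \<in> Poly_Mapping.keys f" "l \<in> Poly_Mapping.keys g"
    "((n1, n2), m1, m2) = k + l"
    using keys_mult[of f g] by blast
  obtain a b c d where k: "k = ((a, b), (c, d))" by (metis surj_pair)
  obtain a' b' c' d' where l: "l = ((a', b'), (c', d'))" by (metis surj_pair)
  have "p * a + q * b = p * q * n \<and> p * c + q * d = p * q * m"
    "p * a' + q * b' = p * q * n' \<and> p * c' + q * d' = p * q * m'"
    using assms kl(1,2) unfolding bihomogeneous_def k l by auto
  moreover have "n1 = a + a'" "n2 = b + b'" "m1 = c + c'" "m2 = d + d'"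
    using kl(3) by (auto simp: k l)
  ultimately show "p * n1 + q * n2 = p * q * (n + n') \<and> p * m1 + q * m2 = p * q * (m + m')"
    by (simp add: distrib_left)
qed

lemma bihomogeneous_single:
  "p * n1 + q * n2 = p * q * n \<Longrightarrow> p * m1 + q * m2 = p * q * m \<Longrightarrow>
    bihomogeneous n m (Poly_Mapping.single ((n1, n2), (m1, m2)) c)"
  by (auto simp: bihomogeneous_def)

lemma bihomogeneous_lin: "bihomogeneous 1 0 (lin a)"
  unfolding lin_def by (intro bihomogeneous_diff bihomogeneous_single) auto

lemma bihomogeneous_clin: "bihomogeneous 0 1 (clin a)"
  unfolding clin_def by (intro bihomogeneous_diff bihomogeneous_single) auto

lemma bihomogeneous_const: "bihomogeneous 0 0 (Poly_Mapping.single 0 c)"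
  using bihomogeneous_single[of 0 0 0 0 0 0 c] by (simp add: zero_prod_def)

lemma bihomogeneous_prod:
  assumes "\<And>i. i \<in> I \<Longrightarrow> bihomogeneous n m (F i)"
  shows "bihomogeneous (card I * n) (card I * m) (\<Prod>i\<in>I. F i)"
  using assms
proof (induction I rule: infinite_finite_induct)
  case (insert x I)
  then show ?case using bihomogeneous_mult[of n m "F x" "card I * n" "card I * m"] by simp
qed (use bihomogeneous_const[of 1] in auto)

end

text \<open>Here \<open>P\<close> and \<open>N\<close> are the zeros that stay fixed, with
  \<open>a\<close> and \<open>b\<close> already removed. The condition \<open>avoid\<close> keeps
  the moving zeros off them and off the singular orbit over 0.\<close>

locale elimination = orbit_action + eliminating_factor +
  fixes P N :: "complex set"
  assumes fin: "finite P" "finite N" and disj: "P \<inter> N = {}"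
    and avoid: "\<And>t w. t \<ge> 0 \<Longrightarrow> w \<in> insert 0 (P \<union> N) \<Longrightarrow> \<psi> t w \<noteq> 0"
    and zero: "0 \<notin> P \<union> N"
begin

definition \<rho> :: "complex \<Rightarrow> complex" where
  "\<rho> w = (\<Prod>x\<in>P. w - x) * (\<Prod>x\<in>N. cnj (w - x))"

definition rest :: mixed_poly where
  "rest = (\<Prod>x\<in>P. lin x) * (\<Prod>x\<in>N. clin x)"

definition slope :: mixed_poly where
  "slope = (lin a * clin a + lin b * clin b) * rest"

definition start :: mixed_poly where
  "start = Poly_Mapping.single 0 \<kappa> * (lin a * clin b) * rest"

text \<open>The homogenisation of \<rho> times \<psi>. Being affine in \<open>t\<close>, it has
  smooth coefficients and \<open>slope\<close> as its derivative in time.\<close>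

definition family :: "real \<Rightarrow> mixed_poly" where
  "family t = Poly_Mapping.single 0 (of_real t) * slope - start"

lemma mixed_eval_family:
  "mixed_eval (family t) z = of_real t * mixed_eval slope z - mixed_eval start z"
  by (simp add: family_def mixed_eval_diff mixed_eval_mult)

lemma bihomogeneous_family: "bihomogeneous (card P + 1) (card N + 1) (family t)"
proof -
  have "bihomogeneous (card P * 1 + card N * 0) (card P * 0 + card N * 1) rest"
    unfolding rest_def
    by (intro bihomogeneous_mult bihomogeneous_prod bihomogeneous_lin bihomogeneous_clin)
  moreover have "bihomogeneous (1 + 0) (0 + 1) (lin a * clin a + lin b * clin b)"
    by (intro bihomogeneous_add bihomogeneous_mult bihomogeneous_lin bihomogeneous_clin)
  moreover have "bihomogeneous (1 + 0) (0 + 1) (lin a * clin b)"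
    by (intro bihomogeneous_mult bihomogeneous_lin bihomogeneous_clin)
  ultimately have "bihomogeneous (card P + 1) (card N + 1) slope"
    "bihomogeneous (card P + 1) (card N + 1) start"
    unfolding slope_def start_def
    using bihomogeneous_mult[of 1 1 _ "card P" "card N" rest] bihomogeneous_mult[OF bihomogeneous_const]
    by force+
  then show ?thesis
    unfolding family_def using bihomogeneous_mult[OF bihomogeneous_const] bihomogeneous_diff by force
qed

definition weight :: "C2 \<Rightarrow> complex" where
  "weight z = (snd z ^ p) ^ (card P + 1) * cnj (snd z ^ p) ^ (card N + 1)"

lemma mixed_eval_factor:
  assumes "snd z \<noteq> 0"
  shows "mixed_eval (lin x) z = snd z ^ p * (fst z ^ q / snd z ^ p - x)"
    and "mixed_eval (clin x) z = cnj (snd z ^ p) * cnj (fst z ^ q / snd z ^ p - x)"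
  using assms by (simp_all add: mixed_eval_lin mixed_eval_clin field_simps)

lemma mixed_eval_rest:
  assumes "snd z \<noteq> 0"
  shows "mixed_eval rest z =
    (snd z ^ p) ^ card P * cnj (snd z ^ p) ^ card N * \<rho> (fst z ^ q / snd z ^ p)"
  unfolding rest_def mixed_eval_mult mixed_eval_prod mixed_eval_factor[OF assms] \<rho>_def
    prod.distrib prod_constant by (simp only: mult_ac)

lemma mixed_eval_slope:
  assumes "snd z \<noteq> 0" "w = fst z ^ q / snd z ^ p"
  shows "mixed_eval slope z =
    weight z * \<rho> w * ((w - a) * cnj (w - a) + (w - b) * cnj (w - b))"
  unfolding slope_def mixed_eval_mult mixed_eval_add mixed_eval_rest[OF assms(1)]
    mixed_eval_factor[OF assms(1)] assms(2)[symmetric]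
  by (simp add: weight_def algebra_simps del: complex_cnj_diff complex_cnj_power)

lemma mixed_eval_start:
  assumes "snd z \<noteq> 0" "w = fst z ^ q / snd z ^ p"
  shows "mixed_eval start z = weight z * \<rho> w * (\<kappa> * (w - a) * cnj (w - b))"
  unfolding start_def mixed_eval_mult mixed_eval_rest[OF assms(1)] mixed_eval_single mixed_monom_0
    mixed_eval_factor[OF assms(1)] assms(2)[symmetric]
  by (simp add: weight_def algebra_simps del: complex_cnj_diff complex_cnj_power)

definition \<phi> :: "real \<Rightarrow> complex \<Rightarrow> complex" where
  "\<phi> t w = \<rho> w * \<psi> t w"

lemma poly_fun_minus_const: "poly_fun (\<lambda>w :: complex. w - x)"
  by (intro poly_fun_diff poly_fun.const poly_fun.lin[OF bounded_linear_ident])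

lemma poly_fun_\<rho>: "poly_fun \<rho>"
  unfolding \<rho>_def by (intro poly_fun.mult poly_fun_prod poly_fun_cnj poly_fun_minus_const)

lemma \<rho>_zero_iff: "\<rho> w = 0 \<longleftrightarrow> w \<in> P \<union> N"
  using fin by (auto simp: \<rho>_def)

lemma models_family:
  assumes "t \<ge> 0"
  shows "models (card P + 1) (card N + 1) (family t) (\<phi> t)"
proof -
  have "mixed_eval (family t) z = (snd z ^ p) ^ (card P + 1) * cnj (snd z ^ p) ^ (card N + 1) *
      \<phi> t (fst z ^ q / snd z ^ p)" if "snd z \<noteq> 0" for z
    unfolding mixed_eval_family mixed_eval_slope[OF that refl] mixed_eval_start[OF that refl]
    by (simp only: weight_def[symmetric] \<phi>_def \<psi>_def) (simp add: algebra_simps)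
  moreover have "mixed_eval (family t) (x, 0) \<noteq> 0" if "x \<noteq> 0" for x
  proof -
    have l: "mixed_eval (lin c) (x, 0) = x ^ q" "mixed_eval (clin c) (x, 0) = cnj (x ^ q)" for c
      using p_pos by (simp_all add: mixed_eval_lin mixed_eval_clin zero_power)
    have "mixed_eval (family t) (x, 0) =
       (of_real (2 * t) - \<kappa>) * (x ^ q * cnj (x ^ q) * mixed_eval rest (x, 0))"
      unfolding mixed_eval_family slope_def start_def mixed_eval_mult mixed_eval_add l
      by (simp add: algebra_simps)
    moreover have "mixed_eval rest (x, 0) = (x ^ q) ^ card P * cnj (x ^ q) ^ card N"
      unfolding rest_def mixed_eval_mult mixed_eval_prod l by simp
    \<comment> \<open>This is nonvanishing at infinity: a unit number other than 1 is never a
      nonnegative real.\<close>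
    moreover have "of_real (2 * t) - \<kappa> \<noteq> 0"
      using denominator_nonzero[of "2 * t" 1] assms by auto
    ultimately show ?thesis using that by auto
  qed
  moreover have "\<phi> t 0 \<noteq> 0"
    using avoid[OF assms, of 0] \<rho>_zero_iff[of 0] zero by (simp add: \<phi>_def)
  moreover have "poly_fun (\<phi> t)"
    unfolding \<phi>_def by (intro poly_fun.mult poly_fun_\<rho> poly_fun_\<psi>)
  ultimately show ?thesis unfolding models_def by blast
qed

section \<open>Jacobians at the fixed and at the moving zeros\<close>

lemma \<phi>_zeros: "{w. \<phi> t w = 0} = P \<union> N \<union> {w. \<psi> t w = 0}"
  using \<rho>_zero_iff by (auto simp: \<phi>_def)

text \<open>Splitting off \<open>w - x\<close> leaves a factor nonzero at \<open>x\<close>, so the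
  differential there is complex linear. At the zeros in \<open>N\<close> it is antilinear by the
  same argument.\<close>

lemma jac_positive_zero:
  assumes "t \<ge> 0" "x \<in> P"
  shows "jac (frechet_derivative (\<phi> t) (at x)) > 0"
proof -
  let ?g = "\<lambda>w. (\<Prod>y\<in>P - {x}. w - y) * (\<Prod>y\<in>N. cnj (w - y)) * \<psi> t w"
  have g: "poly_fun ?g"
    by (intro poly_fun.mult poly_fun_prod poly_fun_cnj poly_fun_minus_const poly_fun_\<psi>)
  have "\<phi> t = (\<lambda>w. ?g w * (w - x))"
    unfolding \<phi>_def \<rho>_def prod.remove[OF fin(1) assms(2)] by (simp add: mult_ac)
  moreover have "((\<lambda>w. w - x) has_derivative (\<lambda>\<eta>. \<eta>)) (at x)"
    by (auto intro!: derivative_eq_intros)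
  ultimately have D: "frechet_derivative (\<phi> t) (at x) = (\<lambda>\<eta>. ?g x * \<eta>)"
    using frechet_derivative_mult_zero[OF g] by simp
  have "?g x \<noteq> 0" using avoid[OF assms(1), of x] fin disj assms(2) by auto
  then show ?thesis unfolding D using jac_wirtinger[of "?g x" 0] by simp
qed

lemma jac_negative_zero:
  assumes "t \<ge> 0" "x \<in> N"
  shows "jac (frechet_derivative (\<phi> t) (at x)) < 0"
proof -
  let ?g = "\<lambda>w. (\<Prod>y\<in>P. w - y) * (\<Prod>y\<in>N - {x}. cnj (w - y)) * \<psi> t w"
  have g: "poly_fun ?g"
    by (intro poly_fun.mult poly_fun_prod poly_fun_cnj poly_fun_minus_const poly_fun_\<psi>)
  have "\<phi> t = (\<lambda>w. ?g w * cnj (w - x))"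
    unfolding \<phi>_def \<rho>_def prod.remove[OF fin(2) assms(2)] by (simp add: mult_ac del: complex_cnj_diff)
  moreover have "((\<lambda>w. cnj (w - x)) has_derivative (\<lambda>\<eta>. cnj \<eta>)) (at x)"
    by (auto intro!: derivative_eq_intros)
  ultimately have D: "frechet_derivative (\<phi> t) (at x) = (\<lambda>\<eta>. ?g x * cnj \<eta>)"
    using frechet_derivative_mult_zero[OF g] by simp
  have "?g x \<noteq> 0" using avoid[OF assms(1), of x] fin disj assms(2) by auto
  then show ?thesis unfolding D using jac_wirtinger[of 0 "?g x"] by simp
qed

lemma arc_derivative:
  assumes "\<psi> t w = 0"
  shows "frechet_derivative (\<phi> t) (at w) = (\<lambda>\<eta>. \<rho> w * (
      (of_real t * (cnj (w - a) + cnj (w - b)) - \<kappa> * cnj (w - b)) * \<eta> +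
      (of_real t * ((w - a) + (w - b)) - \<kappa> * (w - a)) * cnj \<eta>))"
  unfolding \<phi>_def by (rule frechet_derivative_mult_zero[OF poly_fun_\<rho> \<psi>_has_derivative assms])

text \<open>By \<open>avoid\<close> the moving zero is no zero of \<rho>, so the factor \<rho>
  merely rescales the Jacobian of \<psi> by a positive number.\<close>

lemma jac_arc_zero:
  assumes "t \<ge> 0" "\<psi> t w = 0" "x \<ge> 0" "y \<ge> 0" "x \<noteq> 0 \<or> y \<noteq> 0" "w = arc_point x y"
  shows "\<exists>c>0. jac (frechet_derivative (\<phi> t) (at w)) = c * ((y\<^sup>2 - x\<^sup>2) * (1 - 2 * t * Re \<kappa>))"
proof -
  obtain \<mu> where \<mu>: "\<mu> \<noteq> 0" "w - a = cnj \<kappa> * \<mu> * of_real x" "w - b = \<mu> * of_real y"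
    using arc_point_scale[OF assms(3-6)] .
  let ?M = "\<lambda>\<eta>. (of_real t * (cnj (w - a) + cnj (w - b)) - \<kappa> * cnj (w - b)) * \<eta> +
      (of_real t * ((w - a) + (w - b)) - \<kappa> * (w - a)) * cnj \<eta>"
  have "linear ?M" using \<psi>_has_derivative has_derivative_linear by blast
  then have "jac (frechet_derivative (\<phi> t) (at w)) = (cmod (\<rho> w))\<^sup>2 * (cmod 1)\<^sup>2 * jac ?M"
    unfolding arc_derivative[OF assms(2)] using jac_scale[of ?M "\<rho> w" 1] by (simp only: mult_1)
  also have "\<dots> = ((cmod (\<rho> w))\<^sup>2 * (cmod \<mu>)\<^sup>2) * ((y\<^sup>2 - x\<^sup>2) * (1 - 2 * t * Re \<kappa>))"
    unfolding jac_\<psi>[OF \<mu>(2,3)] by simp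
  finally have "jac (frechet_derivative (\<phi> t) (at w)) =
    ((cmod (\<rho> w))\<^sup>2 * (cmod \<mu>)\<^sup>2) * ((y\<^sup>2 - x\<^sup>2) * (1 - 2 * t * Re \<kappa>))" .
  moreover have "(cmod (\<rho> w))\<^sup>2 * (cmod \<mu>)\<^sup>2 > 0"
    using \<mu>(1) \<rho>_zero_iff[of w] avoid[OF assms(1), of w] assms(2) by auto
  ultimately show ?thesis by blast
qed

section \<open>The motion of the two zeros\<close>

definition disc :: "real \<Rightarrow> real" where
  "disc t = sqrt (1 - 4 * t\<^sup>2)"

definition positive_end :: "real \<Rightarrow> complex" where
  "positive_end t = arc_point (2 * t) (1 + disc t)"

definition negative_end :: "real \<Rightarrow> complex" where
  "negative_end t = arc_point (1 + disc t) (2 * t)"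

lemma positive_end_0: "positive_end 0 = a"
  using arc_point_iff[of 0 2 a] by (simp add: positive_end_def disc_def)

lemma negative_end_0: "negative_end 0 = b"
  using arc_point_iff[of 2 0 b] by (simp add: negative_end_def disc_def)

lemma \<psi>_zeros:
  "0 \<le> t \<Longrightarrow> t \<le> 1 / 2 \<Longrightarrow> {w. \<psi> t w = 0} = {positive_end t, negative_end t}"
  using \<psi>_zero_iff by (auto simp: positive_end_def negative_end_def disc_def)

text \<open>Before the merging \<open>2 * t < 1 + disc t\<close>, so
  \<open>y\<^sup>2 - x\<^sup>2\<close> has a definite sign at each end; the remaining factor is
  positive because \<open>Re \<kappa> \<le> 1\<close>.\<close>

lemma jac_ends:
  assumes "0 \<le> t" "t < 1 / 2"
  shows "jac (frechet_derivative (\<phi> t) (at (positive_end t))) > 0"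
    and "jac (frechet_derivative (\<phi> t) (at (negative_end t))) < 0"
proof -
  have "(2 * t)\<^sup>2 < 1\<^sup>2" using assms by (intro power_strict_mono) auto
  then have "disc t > 0" unfolding disc_def by (simp add: power_mult_distrib)
  have z: "\<psi> t (positive_end t) = 0" "\<psi> t (negative_end t) = 0"
    using \<psi>_zeros[of t] assms by auto
  have "t * Re \<kappa> \<le> t * 1"
    using complex_Re_le_cmod[of \<kappa>] unit assms(1) by (intro mult_left_mono) auto
  then have k: "1 - 2 * t * Re \<kappa> > 0" using assms(2) by simp
  have "(2 * t)\<^sup>2 < (1 + disc t)\<^sup>2"
    using assms \<open>disc t > 0\<close> by (intro power_strict_mono) auto
  then have g: "((1 + disc t)\<^sup>2 - (2 * t)\<^sup>2) * (1 - 2 * t * Re \<kappa>) > 0"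
    "((2 * t)\<^sup>2 - (1 + disc t)\<^sup>2) * (1 - 2 * t * Re \<kappa>) < 0"
    using k by (auto intro: mult_pos_pos mult_neg_pos)
  have nn: "2 * t \<ge> 0" "1 + disc t \<ge> 0" "2 * t \<noteq> 0 \<or> 1 + disc t \<noteq> 0" "1 + disc t \<noteq> 0 \<or> 2 * t \<noteq> 0"
    using assms(1) \<open>disc t > 0\<close> by auto
  show "jac (frechet_derivative (\<phi> t) (at (positive_end t))) > 0"
    using jac_arc_zero[OF assms(1) z(1) nn(1,2,3) positive_end_def] g(1) by (auto intro: mult_pos_pos)
  show "jac (frechet_derivative (\<phi> t) (at (negative_end t))) < 0"
    using jac_arc_zero[OF assms(1) z(2) nn(2,1,4) negative_end_def] g(2) by (auto intro: mult_pos_neg)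
qed

lemma family_before:
  assumes "0 \<le> t" "t < 1 / 2" "card P + 1 = d + r" "card N + 1 = r"
  shows "oriented_link_of (family t) =
      orbit_link (insert (positive_end t) P) (insert (negative_end t) N)"
    and "orbit_link (insert (positive_end t) P) (insert (negative_end t) N) \<in> link_space_neg p q d r"
    and "insert (positive_end t) P \<inter> insert (negative_end t) N = {}"
    and "0 \<notin> insert (positive_end t) P \<union> insert (negative_end t) N"
proof -
  have ends: "{w. \<psi> t w = 0} = {positive_end t, negative_end t}"
    using assms(1,2) by (intro \<psi>_zeros) auto
  then have z: "\<psi> t (positive_end t) = 0" "\<psi> t (negative_end t) = 0" by blast+
  have P: "jac (frechet_derivative (\<phi> t) (at w)) > 0" if "w \<in> insert (positive_end t) P" for w
    using that jac_ends(1)[OF assms(1,2)] jac_positive_zero[OF assms(1)] by auto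
  have N: "jac (frechet_derivative (\<phi> t) (at w)) < 0" if "w \<in> insert (negative_end t) N" for w
    using that jac_ends(2)[OF assms(1,2)] jac_negative_zero[OF assms(1)] by auto
  have out: "positive_end t \<notin> P" "negative_end t \<notin> N" using avoid[OF assms(1)] z by auto
  have zeros: "{w. \<phi> t w = 0} = insert (positive_end t) P \<union> insert (negative_end t) N"
    unfolding \<phi>_zeros ends by blast
  show "oriented_link_of (family t) =
      orbit_link (insert (positive_end t) P) (insert (negative_end t) N)"
    "orbit_link (insert (positive_end t) P) (insert (negative_end t) N) \<in> link_space_neg p q d r"
    using link_space_negI[OF bihomogeneous_family _ models_family[OF assms(1)] _ _ zeros P N, of d r]
      fin out assms(3,4) by auto
  show "insert (positive_end t) P \<inter> insert (negative_end t) N = {}" using P N by fastforce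
  show "0 \<notin> insert (positive_end t) P \<union> insert (negative_end t) N"
    using models_family[OF assms(1)] zeros unfolding models_def by blast
qed

lemma family_after:
  assumes "t > 1 / 2" "card P + 1 = d + r" "card N + 1 = r"
  shows "oriented_link_of (family t) \<in> link_space_neg p q d (r - 1)"
proof -
  have t: "t \<ge> 0" using assms(1) by simp
  have zeros: "{w. \<phi> t w = 0} = P \<union> N"
    unfolding \<phi>_zeros using \<psi>_nonzero[OF assms(1)] by auto
  \<comment> \<open>The subtraction \<open>r - 1\<close> is exact, as \<open>card N + 1 = r\<close>.
    The degrees are still \<open>card P + 1\<close> and \<open>card N + 1\<close>, although only
    \<open>P\<close> and \<open>N\<close> remain as zeros.\<close>
  show ?thesis
    using link_space_negI[OF bihomogeneous_family _ models_family[OF t] fin zeros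
        jac_positive_zero[OF t] jac_negative_zero[OF t], of d "r - 1"] assms(2,3) by simp
qed

section \<open>The merging time\<close>

lemma disc_half: "disc (1 / 2) = 0" by (simp add: disc_def power2_eq_square)

lemma ends_half: "positive_end (1 / 2) = arc_point 1 1" "negative_end (1 / 2) = arc_point 1 1"
  by (simp_all add: positive_end_def negative_end_def disc_half)

lemma \<psi>_half: "\<psi> (1 / 2) (arc_point 1 1) = 0"
  using \<psi>_zeros[of "1 / 2"] ends_half by auto

lemma limit_nonzero: "arc_point 1 1 \<noteq> 0"
  using \<psi>_half avoid[of "1 / 2" 0] by auto

lemma ends_converge:
  "(positive_end \<longlongrightarrow> arc_point 1 1) (at_left (1 / 2))"
  "(negative_end \<longlongrightarrow> arc_point 1 1) (at_left (1 / 2))"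
proof -
  have lim: "((\<lambda>t. arc_point (f t) (g t)) \<longlongrightarrow> arc_point 1 1) F"
    if "(f \<longlongrightarrow> 1) F" "(g \<longlongrightarrow> 1) F" for f g :: "real \<Rightarrow> real" and F
    unfolding arc_point_def by (intro tendsto_intros that) (use not_one in auto)
  have 1: "((\<lambda>t. 2 * t :: real) \<longlongrightarrow> 1) (at_left (1 / 2))"
    by (auto intro!: tendsto_eq_intros)
  have 2: "((\<lambda>t. 1 + disc t) \<longlongrightarrow> 1) (at_left (1 / 2))"
    unfolding disc_def by (auto intro!: tendsto_eq_intros simp: power2_eq_square)
  show "(positive_end \<longlongrightarrow> arc_point 1 1) (at_left (1 / 2))"
    unfolding positive_end_def by (rule lim[OF 1 2])
  show "(negative_end \<longlongrightarrow> arc_point 1 1) (at_left (1 / 2))"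
    unfolding negative_end_def by (rule lim[OF 2 1])
qed

lemma limit_component:
  "orbit (arc_point 1 1) \<in> components (link_of (family (1 / 2)))"
  "z \<in> orbit (arc_point 1 1) \<Longrightarrow> \<not> transverse_at (family (1 / 2)) z"
proof -
  have m: "models (card P + 1) (card N + 1) (family (1 / 2)) (\<phi> (1 / 2))"
    by (rule models_family) simp
  have zeros: "{w. \<phi> (1 / 2) w = 0} = insert (arc_point 1 1) (P \<union> N)"
    unfolding \<phi>_zeros using \<psi>_zeros[of "1 / 2"] ends_half by auto
  have "components (link_of (family (1 / 2))) = orbit ` (insert (arc_point 1 1) (P \<union> N))"
    unfolding link_of_models[OF m] zeros
    by (rule components_orbits) (use fin zero limit_nonzero in auto)
  then show "orbit (arc_point 1 1) \<in> components (link_of (family (1 / 2)))" by simp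
  have z: "\<phi> (1 / 2) (arc_point 1 1) = 0" using \<psi>_half by (simp add: \<phi>_def)
  \<comment> \<open>At \<open>x = y = 1\<close> the factor \<open>y\<^sup>2 - x\<^sup>2\<close>
    vanishes.\<close>
  have "jac (frechet_derivative (\<phi> (1 / 2)) (at (arc_point 1 1))) = 0"
    using jac_arc_zero[OF _ \<psi>_half, of 1 1] by auto
  then show "z \<in> orbit (arc_point 1 1) \<Longrightarrow> \<not> transverse_at (family (1 / 2)) z"
    using not_transverse[OF m _ z] by blast
qed

text \<open>The differential of the equation in space and time is onto. Time is used only at
  \<open>t = 1 / 2\<close>, so the end times meet the stricter boundary requirement.\<close>

lemma family_submersion:
  assumes t: "t \<ge> 0" and z: "z \<in> link_of (family t)"
  shows "\<exists>v s. z \<bullet> v = 0 \<and> (t \<noteq> 1 / 2 \<longrightarrow> s = 0) \<and>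
    frechet_derivative (mixed_eval (family t)) (at z) v + of_real s * mixed_eval slope z = y"
proof -
  have m: "models (card P + 1) (card N + 1) (family t) (\<phi> t)" by (rule models_family[OF t])
  obtain w where w: "z \<in> orbit w" "\<phi> t w = 0" using z unfolding link_of_models[OF m] by auto
  have "w \<noteq> 0" using m w(2) by (auto simp: models_def)
  then have nz: "fst z \<noteq> 0" "snd z \<noteq> 0" using orbit_fst_nonzero orbit_snd_nonzero w(1) by auto
  note ratio = orbit_ratio[OF w(1), symmetric]
  show ?thesis
  proof (cases "jac (frechet_derivative (\<phi> t) (at w)) = 0")
    case False
    obtain M where M: "linear M" "(mixed_eval (family t) has_derivative (\<lambda>v. M (normal_form z v))) (at z)"
      "sgn (jac M) = sgn (jac (frechet_derivative (\<phi> t) (at w)))"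
      using models_normal_map[OF m nz ratio w(2)] .
    have D: "frechet_derivative (mixed_eval (family t)) (at z) = (\<lambda>v. M (normal_form z v))"
      using M(2) by (rule frechet_derivative_at[symmetric])
    have "jac M \<noteq> 0" using False M(3) by (metis sgn_zero_iff)
    then obtain \<omega> where "M \<omega> = y" using jac_nonzero_surj[OF M(1)] by blast
    moreover obtain v where "z \<bullet> v = 0" "normal_form z v = \<omega>" using normal_form_surj[OF nz(2)] by blast
    ultimately show ?thesis unfolding D by (intro exI[of _ v] exI[of _ 0]) simp
  next
    case True
    then have "w \<notin> P \<union> N" using jac_positive_zero[OF t, of w] jac_negative_zero[OF t, of w] by auto
    then have \<rho>: "\<rho> w \<noteq> 0" using \<rho>_zero_iff by blast
    then have \<psi>0: "\<psi> t w = 0" using w(2) by (simp add: \<phi>_def)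
    then have "t \<le> 1 / 2" using \<psi>_nonzero[of t w] by linarith
    then have "w = positive_end t \<or> w = negative_end t" using \<psi>_zeros[OF t] \<psi>0 by auto
    then have "\<not> t < 1 / 2" using True jac_ends[OF t] by auto
    with \<open>t \<le> 1 / 2\<close> have th: "t = 1 / 2" by simp
    then have "w = arc_point 1 1" using \<open>w = positive_end t \<or> w = negative_end t\<close> ends_half by metis
    then obtain \<mu> where \<mu>: "\<mu> \<noteq> 0" "w - a = cnj \<kappa> * \<mu>" "w - b = \<mu>"
      using arc_point_scale[of 1 1 w] by auto
    have kk: "\<kappa> * cnj \<kappa> = 1" using unit complex_norm_square[of \<kappa>] by simp
    \<comment> \<open>The two Wirtinger coefficients at the merged zero turn out to be
      \<open>\<gamma> / 2\<close> and \<open>- cnj \<gamma> / 2\<close>, so the differential sends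
      \<eta> to \<i> times the imaginary part of \<open>\<gamma> * \<eta>\<close>.\<close>
    define \<gamma> where "\<gamma> = cnj \<mu> * (1 - \<kappa>)"
    have g0: "\<gamma> \<noteq> 0" using \<mu>(1) not_one by (simp add: \<gamma>_def)
    have c1: "of_real t * (cnj (w - a) + cnj (w - b)) - \<kappa> * cnj (w - b) = \<gamma> / 2"
      unfolding \<mu>(2,3) th by (simp add: \<gamma>_def field_simps)
    have "of_real t * ((w - a) + (w - b)) - \<kappa> * (w - a) = \<mu> * ((cnj \<kappa> + 1) / 2 - \<kappa> * cnj \<kappa>)"
      unfolding \<mu>(2,3) th by (simp add: field_simps)
    then have c2: "of_real t * ((w - a) + (w - b)) - \<kappa> * (w - a) = - cnj \<gamma> / 2"
      unfolding kk by (simp add: \<gamma>_def field_simps)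
    have D: "frechet_derivative (mixed_eval (family t)) (at z) = (\<lambda>v. weight z *
      (\<rho> w * ((\<gamma> / 2) * (w / (fst z * snd z) * normal_form z v) +
        (- cnj \<gamma> / 2) * cnj (w / (fst z * snd z) * normal_form z v))))"
      using frechet_derivative_at[OF models_has_derivative[OF m nz ratio w(2)], symmetric]
      unfolding arc_derivative[OF \<psi>0] c1 c2 weight_def .
    have sl: "mixed_eval slope z = weight z * \<rho> w * of_real (2 * (cmod \<mu>)\<^sup>2)"
    proof -
      have "(w - a) * cnj (w - a) + (w - b) * cnj (w - b) = (\<kappa> * cnj \<kappa> + 1) * (\<mu> * cnj \<mu>)"
        unfolding \<mu>(2,3) by (simp add: algebra_simps)
      also have "\<dots> = of_real (2 * (cmod \<mu>)\<^sup>2)"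
        unfolding kk unfolding complex_norm_square[symmetric] by simp
      finally show ?thesis unfolding mixed_eval_slope[OF nz(2) ratio] by simp
    qed
    have W: "weight z * \<rho> w \<noteq> 0" using nz(2) \<rho> by (simp add: weight_def)
    \<comment> \<open>The target without the common factor: its imaginary part is reached by moving
      on the sphere, its real part by moving in time.\<close>
    define y' where "y' = y / (weight z * \<rho> w)"
    obtain v where v: "z \<bullet> v = 0" "normal_form z v = \<i> * of_real (Im y') / \<gamma> / (w / (fst z * snd z))"
      using normal_form_surj[OF nz(2)] by blast
    define \<eta> where "\<eta> = w / (fst z * snd z) * normal_form z v"
    have ge: "\<gamma> * \<eta> = \<i> * of_real (Im y')"
      unfolding \<eta>_def v(2) using g0 nz \<open>w \<noteq> 0\<close> by simp
    have "(\<gamma> / 2) * \<eta> + (- cnj \<gamma> / 2) * cnj \<eta> = (\<gamma> * \<eta> - cnj (\<gamma> * \<eta>)) / 2"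
      by (simp add: field_simps)
    also have "\<dots> = \<i> * of_real (Im y')" unfolding ge by simp
    finally have e: "(\<gamma> / 2) * \<eta> + (- cnj \<gamma> / 2) * cnj \<eta> = \<i> * of_real (Im y')" .
    have mm: "2 * (cmod \<mu>)\<^sup>2 \<noteq> 0" using \<mu>(1) by simp
    define s where "s = Re y' / (2 * (cmod \<mu>)\<^sup>2)"
    have "of_real s * complex_of_real (2 * (cmod \<mu>)\<^sup>2) = of_real (s * (2 * (cmod \<mu>)\<^sup>2))"
      by (rule of_real_mult[symmetric])
    also have "s * (2 * (cmod \<mu>)\<^sup>2) = Re y'" unfolding s_def using mm by simp
    finally have sm: "of_real s * complex_of_real (2 * (cmod \<mu>)\<^sup>2) = of_real (Re y')" .
    have "frechet_derivative (mixed_eval (family t)) (at z) v + of_real s * mixed_eval slope z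
      = weight z * \<rho> w * (\<i> * of_real (Im y') + of_real s * complex_of_real (2 * (cmod \<mu>)\<^sup>2))"
      unfolding D sl \<eta>_def[symmetric] e by (simp only: distrib_left mult_ac)
    also have "\<i> * of_real (Im y') + of_real s * complex_of_real (2 * (cmod \<mu>)\<^sup>2) = y'"
      unfolding sm by (simp add: complex_eq_iff)
    also have "weight z * \<rho> w * y' = y" unfolding y'_def using W by simp
    finally show ?thesis using v(1) th by blast
  qed
qed

text \<open>One global equation suffices: \<open>h\<close> is the family with the parameter promoted
  to a variable, so \<open>U\<close> is the whole space.\<close>

lemma family_smooth_codim_two:
  "smooth_codim_two {(z, t). t \<in> {0..1} \<and> z \<in> link_of (family t)}" (is "smooth_codim_two ?W")
proof -
  define h where "h x = of_real (snd x) * mixed_eval slope (fst x) - mixed_eval start (fst x)"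
    for x :: "C2 \<times> real"
  have ph: "poly_fun h"
    unfolding h_def
    by (intro poly_fun_diff poly_fun.mult poly_fun_compose_linear[OF poly_fun_mixed_eval]
        bounded_linear_fst poly_fun.lin[OF bounded_linear_compose[OF bounded_linear_of_real bounded_linear_snd]])
  have h: "h (z, t) = mixed_eval (family t) z" for z t
    by (simp add: h_def mixed_eval_family)
  have sub: "frechet_derivative h (at (z, t)) `
      {(v, s). z \<bullet> v = 0 \<and> (t = 0 \<or> t = 1 \<longrightarrow> s = 0)} = UNIV"
    if t: "t \<in> {0..1}" and z: "z \<in> link_of (family t)" for z t
  proof -
    let ?D = "frechet_derivative (mixed_eval (family t)) (at z)"
    let ?F = "frechet_derivative (mixed_eval slope) (at z)"
    let ?G = "frechet_derivative (mixed_eval start) (at z)"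
    have F: "(mixed_eval slope has_derivative ?F) (at z)"
      and G: "(mixed_eval start has_derivative ?G) (at z)"
      by (rule poly_fun_frechet(1)[OF poly_fun_mixed_eval])+
    have "((\<lambda>z. of_real t * mixed_eval slope z - mixed_eval start z) has_derivative
        (\<lambda>v. of_real t * ?F v - ?G v)) (at z)"
      by (intro has_derivative_diff has_derivative_mult_right F G)
    then have D: "?D = (\<lambda>v. of_real t * ?F v - ?G v)"
      unfolding mixed_eval_family[abs_def, symmetric] by (rule frechet_derivative_at[symmetric])
    have f: "((\<lambda>x :: C2 \<times> real. g (fst x)) has_derivative (\<lambda>x. g' (fst x))) (at (z, t))"
      if "(g has_derivative g') (at z)" for g g' :: "C2 \<Rightarrow> complex"
      using has_derivative_compose[OF bounded_linear_imp_has_derivative[OF bounded_linear_fst],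
          where x = "(z, t)" and g = g and g' = g'] that by simp
    have "(h has_derivative (\<lambda>x. (of_real t * ?F (fst x) + of_real (snd x) * mixed_eval slope z)
        - ?G (fst x))) (at (z, t))"
    proof -
      have "((\<lambda>x :: C2 \<times> real. complex_of_real (snd x)) has_derivative (\<lambda>x. of_real (snd x))) (at (z, t))"
        by (intro has_derivative_of_real has_derivative_snd has_derivative_ident)
      from has_derivative_diff[OF has_derivative_mult[OF this f[OF F]] f[OF G]]
      show ?thesis unfolding h_def[abs_def] by simp
    qed
    then have dh: "frechet_derivative h (at (z, t)) =
        (\<lambda>x. (of_real t * ?F (fst x) + of_real (snd x) * mixed_eval slope z) - ?G (fst x))"
      by (rule frechet_derivative_at[symmetric])
    show ?thesis
    proof (intro equalityI subsetI UNIV_I)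
      fix y
      have t0: "t \<ge> 0" using t by simp
      obtain v s where vs: "z \<bullet> v = 0" "t \<noteq> 1 / 2 \<longrightarrow> s = 0" "?D v + of_real s * mixed_eval slope z = y"
        using family_submersion[OF t0 z, of y] by blast
      have "frechet_derivative h (at (z, t)) (v, s) = y"
        unfolding dh using vs(3) unfolding D by (simp add: algebra_simps)
      moreover have "(v, s) \<in> {(v, s). z \<bullet> v = 0 \<and> (t = 0 \<or> t = 1 \<longrightarrow> s = 0)}"
        using vs(1,2) by auto
      ultimately show "y \<in> frechet_derivative h (at (z, t)) `
          {(v, s). z \<bullet> v = 0 \<and> (t = 0 \<or> t = 1 \<longrightarrow> s = 0)}" by blast
    qed
  qed
  have W: "?W \<inter> UNIV = {x \<in> UNIV \<inter> (sphere 0 1 \<times> {0..1}). h x = 0}"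
    using h by (auto simp: link_of_def)
  have "\<exists>U h. open U \<and> (z, t) \<in> U \<and> smooth_map_on U h \<and>
        ?W \<inter> U = {x \<in> U \<inter> (sphere 0 1 \<times> {0..1}). h x = 0} \<and>
        frechet_derivative (h :: C2 \<times> real \<Rightarrow> complex) (at (z, t)) `
          {(v, s). z \<bullet> v = 0 \<and> (t = 0 \<or> t = 1 \<longrightarrow> s = 0)} = UNIV"
    if "(z, t) \<in> ?W" for z t
  proof (rule exI[of _ UNIV], rule exI[of _ h], intro conjI)
    show "smooth_map_on UNIV h" by (rule poly_fun_smooth[OF ph])
    show "frechet_derivative h (at (z, t)) `
          {(v, s). z \<bullet> v = 0 \<and> (t = 0 \<or> t = 1 \<longrightarrow> s = 0)} = UNIV"
      by (rule sub) (use that in auto)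
  qed (use W in auto)
  moreover have "?W \<subseteq> sphere 0 1 \<times> {0..1}" by (auto simp: link_of_def)
  ultimately show ?thesis unfolding smooth_codim_two_def by blast
qed

lemma family_elimination:
  assumes card: "card P + 1 = d + r" "card N + 1 = r"
  shows "smooth_elimination_family p q d r (\<lambda>t. oriented_link_of (family t))"
  unfolding smooth_elimination_family_def
proof (rule exI[of _ family], intro conjI)
  show "\<forall>t\<in>{0..1}. oriented_link_of (family t) = oriented_link_of (family t) \<and>
      (\<exists>dr. strongly_polar_weighted_homogeneous p q dr (int (d * p * q)) (family t))"
    using bihomogeneous_imp_polar[OF bihomogeneous_family] card by fastforce
  show "\<forall>m. smooth_map_on {0..1} (\<lambda>t. Poly_Mapping.lookup (family t) m)"
  proof
    fix m
    have "poly_fun (\<lambda>t. of_real t * Poly_Mapping.lookup slope m - Poly_Mapping.lookup start m)"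
      by (intro poly_fun_diff poly_fun.mult poly_fun.const poly_fun.lin bounded_linear_of_real)
    then show "smooth_map_on {0..1} (\<lambda>t. Poly_Mapping.lookup (family t) m)"
      unfolding family_def lookup_minus lookup_scale by (rule poly_fun_smooth)
  qed
  show "smooth_codim_two {(z, t). t \<in> {0..1} \<and> z \<in> fst (oriented_link_of (family t))}"
    using family_smooth_codim_two by (simp add: oriented_link_of_def)
  note before = family_before[OF _ _ card]
  show "\<exists>t0. 0 < t0 \<and> t0 < 1 \<and>
      (\<forall>t. 0 \<le> t \<and> t < t0 \<longrightarrow> oriented_link_of (family t) \<in> link_space_neg p q d r) \<and>
      (\<forall>t. t0 < t \<and> t \<le> 1 \<longrightarrow> oriented_link_of (family t) \<in> link_space_neg p q d (r - 1)) \<and>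
      (\<exists>C\<in>components (fst (oriented_link_of (family t0))).
         (\<forall>z\<in>C. \<not> transverse_at (family t0) z) \<and>
         (\<exists>A B. (\<forall>t. 0 \<le> t \<and> t < t0 \<longrightarrow>
              A t \<in> positive_components p q (oriented_link_of (family t)) \<and>
              B t \<in> negative_components p q (oriented_link_of (family t))) \<and>
            sets_converge A C (at_left t0) \<and> sets_converge B C (at_left t0)))"
  proof (rule exI[of _ "1 / 2"], intro conjI)
    show "\<forall>t. 0 \<le> t \<and> t < 1 / 2 \<longrightarrow> oriented_link_of (family t) \<in> link_space_neg p q d r"
      using before(1,2) by simp
    show "\<forall>t. 1 / 2 < t \<and> t \<le> 1 \<longrightarrow> oriented_link_of (family t) \<in> link_space_neg p q d (r - 1)"
      using family_after[OF _ card] by blast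
    have "orbit (positive_end t) \<in> positive_components p q (oriented_link_of (family t)) \<and>
        orbit (negative_end t) \<in> negative_components p q (oriented_link_of (family t))"
      if t: "0 \<le> t \<and> t < 1 / 2" for t
    proof -
      have "finite (insert (positive_end t) P)" "finite (insert (negative_end t) N)" using fin by auto
      note signed = signed_components_orbit_link[OF this before(4,3)]
      show ?thesis using t before(1)[of t] signed by simp
    qed
    then have ends: "\<exists>A B. (\<forall>t. 0 \<le> t \<and> t < 1 / 2 \<longrightarrow>
          A t \<in> positive_components p q (oriented_link_of (family t)) \<and>
          B t \<in> negative_components p q (oriented_link_of (family t))) \<and>
        sets_converge A (orbit (arc_point 1 1)) (at_left (1 / 2)) \<and>
        sets_converge B (orbit (arc_point 1 1)) (at_left (1 / 2))"
      using orbits_converge[OF ends_converge(1) limit_nonzero]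
        orbits_converge[OF ends_converge(2) limit_nonzero]
      by - (rule exI[of _ "\<lambda>t. orbit (positive_end t)"],
          rule exI[of _ "\<lambda>t. orbit (negative_end t)"], blast)
    show "\<exists>C\<in>components (fst (oriented_link_of (family (1 / 2)))).
         (\<forall>z\<in>C. \<not> transverse_at (family (1 / 2)) z) \<and>
         (\<exists>A B. (\<forall>t. 0 \<le> t \<and> t < 1 / 2 \<longrightarrow>
              A t \<in> positive_components p q (oriented_link_of (family t)) \<and>
              B t \<in> negative_components p q (oriented_link_of (family t))) \<and>
            sets_converge A C (at_left (1 / 2)) \<and> sets_converge B C (at_left (1 / 2)))"
    proof (rule bexI[of _ "orbit (arc_point 1 1)"], rule conjI)
      show "\<forall>z\<in>orbit (arc_point 1 1). \<not> transverse_at (family (1 / 2)) z"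
        using limit_component(2) by blast
      show "orbit (arc_point 1 1) \<in> components (fst (oriented_link_of (family (1 / 2))))"
        using limit_component(1) by (simp add: oriented_link_of_def)
    qed (rule ends)
  qed auto
qed

end

theorem theorem6:
  fixes p q d r :: nat and L :: oriented_link
  assumes "p > 0" and "q > 0" and "coprime p q"
    and "d \<ge> 1" and "r > 0"
    and "L \<in> link_space_neg p q d r"
  shows "\<exists>Lt :: real \<Rightarrow> oriented_link.
           smooth_elimination_family p q d r Lt \<and>
           Lt 0 = L \<and> Lt 1 \<in> link_space_neg p q d (r - 1)"
proof -
  interpret orbit_action p q by unfold_locales (use assms in auto)
  obtain P N where PN: "finite P" "finite N" "0 \<notin> P \<union> N" "P \<inter> N = {}"
    "card P = d + r" "card N = r" "L = orbit_link P N"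
    using link_space_negE[OF assms(6,5)] .
  have "P \<noteq> {}" "N \<noteq> {}" using PN(5,6) assms(5) by auto
  then obtain a b where ab: "a \<in> P" "b \<in> N" by blast
  define X where "X w = (w - a) * cnj (w - b)" for w
  \<comment> \<open>Each forbidden \<open>w\<close> excludes the unit number that rotates
    \<open>X w\<close> onto the positive real axis; the value 1 is excluded for infinity.\<close>
  define E where "E = insert 1 ((\<lambda>w. of_real (cmod (X w)) / X w) ` insert 0 (P \<union> N))"
  have "finite E" using PN(1,2) by (simp add: E_def)
  then obtain \<kappa> where \<kappa>: "cmod \<kappa> = 1" "\<kappa> \<notin> E" by (rule unit_complex_avoiding)
  interpret F: eliminating_factor a b \<kappa>
    by unfold_locales (use ab PN(4) \<kappa> in \<open>auto simp: E_def\<close>)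
  text \<open>A zero at \<open>w\<close> would make \<open>\<kappa> * X w\<close> a nonnegative real.\<close>
  have avoid: "F.\<psi> t w \<noteq> 0" if t: "t \<ge> 0" and w: "w \<in> insert 0 (P - {a} \<union> (N - {b}))" for t w
  proof
    assume "F.\<psi> t w = 0"
    then have "\<kappa> * X w = of_real t * ((w - a) * cnj (w - a) + (w - b) * cnj (w - b))"
      by (simp add: F.\<psi>_def X_def mult.assoc)
    also have "\<dots> = of_real (t * ((cmod (w - a))\<^sup>2 + (cmod (w - b))\<^sup>2))"
      unfolding complex_norm_square[symmetric] by simp
    finally obtain x where x: "\<kappa> * X w = of_real x" "x \<ge> 0" using t by (metis add_nonneg_nonneg
          mult_nonneg_nonneg zero_le_power2)
    then have "cmod (\<kappa> * X w) = x" by simp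
    then have "x = cmod (X w)" using \<kappa>(1) by (simp add: norm_mult)
    moreover have "X w \<noteq> 0" using w ab PN(3,4) by (auto simp: X_def)
    ultimately have "\<kappa> = of_real (cmod (X w)) / X w" using x(1) by (simp add: field_simps)
    then have "\<kappa> \<in> E" using w by (auto simp: E_def)
    then show False using \<kappa>(2) by blast
  qed
  interpret elimination p q a b \<kappa> "P - {a}" "N - {b}"
    by unfold_locales (use PN avoid in auto)
  have card: "card (P - {a}) + 1 = d + r" "card (N - {b}) + 1 = r"
    using PN(1,2,5,6) ab assms(5) by (simp_all add: card_Diff_singleton)
  show ?thesis
  proof (intro exI conjI)
    show "smooth_elimination_family p q d r (\<lambda>t. oriented_link_of (family t))"
      by (rule family_elimination[OF card])
    \<comment> \<open>At time 0 the moving zeros are \<open>a\<close> and \<open>b\<close>, which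
      restore the sets \<open>P\<close> and \<open>N\<close>.\<close>
    show "oriented_link_of (family 0) = L"
      using family_before(1)[OF _ _ card, of 0] ab PN(7)
      by (simp add: positive_end_0 negative_end_0 insert_absorb)
    show "oriented_link_of (family 1) \<in> link_space_neg p q d (r - 1)"
      by (rule family_after[OF _ card]) simp
  qed
qed

end
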